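(* Let $U\subseteq\mathbb{C}$ be open and connected, let $f$ be a nonconstant meromorphic function on $U$, and let $z_0\in U$ be a simple root of $f$ (so $f(z_0)=0\neq f'(z_0)$). Suppose $f''(z_0)\neq0$. Let $h_{f,z_0}:\mathcal{A}(f,z_0)\to[0,1)$ be the potential function of the secant map $\mathcal{S}_f$ for the fixed point $(z_0,z_0)$. Then the Green's function $\log\circ h_{f,z_0}$ is pluriharmonic at every point of $\mathcal{A}(f,z_0)$ where it is finite, i.e. on the complement in $\mathcal{A}(f,z_0)$ of the set $h_{f,z_0}^{-1}(\{0\})=\bigcup_{n\geq0}\mathcal{S}_f^{\circ(-n)}(\{(z_0,z_0)\})$ of iterated preimages of $(z_0,z_0)$: every point of this complement has an open neighborhood on which $\log\circ h_{f,z_0}$ is the real part of a holomorphic function.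
   Context: Secant map: $\mathcal{S}_f:U\times U\dashrightarrow\mathbb{P}^1\times\mathbb{P}^1$ is given by $$\mathcal{S}_f(x,y)=\left(\frac{f(x)y-f(y)x}{f(x)-f(y)},\,x\right),$$ and is extended holomorphically to all points of $U\times U$ where such an extension exists; remaining points are indeterminate and excluded from its domain. In particular $\mathcal{S}_f(x,x)=\left(x-\frac{f(x)}{f'(x)},x\right)$ if $x$ is not a pole and $f'(x)\neq0$; $\mathcal{S}_f(x,y)=(y,x)$ if $x$ is a pole of $f$ and $y$ is not; and $\mathcal{S}_f(x,y)=(x,x)$ if $y$ is a pole and $x$ is not. An iterate $\mathcal{S}_f^{\circ n}(x,y)$ is defined when the preceding iterates lie in $U\times U$ and in the domain of $\mathcal{S}_f$. For a simple root $z_0$ of $f$, $(z_0,z_0)$ is a superattracting fixed point of $\mathcal{S}_f$, and its basin of attraction is $$\mathcal{A}(f,z_0)=\left\{(x,y)\in U\times U:\ \lim_{n\to\infty}\mathcal{S}_f^{\circ n}(x,y)=(z_0,z_0)\right\}$$ (all iterates being defined and in $U\times U$). It is nonempty, open, and fully invariant under $\mathcal{S}_f$. For a set $E$, $\mathcal{S}_f^{\circ(-n)}(E)$ denotes the set of points $(x,y)\in U\times U$ with $\mathcal{S}_f^{\circ n}(x,y)$ defined and in $E$. Potential function: with $\phi=\frac12(1+\sqrt5)$ and any norm $\|\cdot\|$ on $\mathbb{C}^2$, $$h_{f,z_0}(x,y)=\lim_{n\to\infty}\left\|\mathcal{S}_f^{\circ n}(x,y)-(z_0,z_0)\right\|^{1/\phi^n},\qquad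 (x,y)\in\mathcal{A}(f,z_0);$$ when $f''(z_0)\neq0$ this limit exists for every point of the basin, does not depend on the norm, lies in $[0,1)$, and vanishes exactly on the iterated preimages of $(z_0,z_0)$. By convention $\log 0=-\infty$. *)

theory Defs
  imports "HOL-Complex_Analysis.Complex_Analysis"
begin

section \<open>Holomorphic functions of two variables\<close>

definition holomorphic2_on ::
    "(complex \<times> complex \<Rightarrow> complex) \<Rightarrow> (complex \<times> complex) set \<Rightarrow> bool" where
  "holomorphic2_on F W \<longleftrightarrow>
     open W \<and> (\<forall>p\<in>W. \<exists>a b. (F has_derivative (\<lambda>(u, v). a * u + b * v)) (at p))"

definition pluriharmonic_at ::
    "(complex \<times> complex) set \<Rightarrow> (complex \<times> complex \<Rightarrow> ereal) \<Rightarrow> complex \<times> complex \<Rightarrow> bool" where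
  "pluriharmonic_at A u p \<longleftrightarrow>
     (\<exists>V F. open V \<and> p \<in> V \<and> V \<subseteq> A \<and> holomorphic2_on F V \<and> (\<forall>q\<in>V. u q = ereal (Re (F q))))"

definition norm_on_C2 :: "(complex \<times> complex \<Rightarrow> real) \<Rightarrow> bool" where
  "norm_on_C2 N \<longleftrightarrow>
     (\<forall>v. 0 \<le> N v) \<and> (\<forall>v. N v = 0 \<longleftrightarrow> v = 0) \<and>
     (\<forall>c x y. N (c * x, c * y) = cmod c * N (x, y)) \<and>
     (\<forall>v w. N (v + w) \<le> N v + N w)"


section \<open>The Riemann sphere\<close>

datatype P1 = Fin complex | Infty

text \<open>The inverse of the chart \<open>1/w\<close> around \<open>Infty\<close>.\<close>

definition chart_infty :: "complex \<Rightarrow> P1" where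
  "chart_infty w = (if w = 0 then Infty else Fin (inverse w))"

definition holomorphic_P1_on ::
    "(complex \<times> complex \<Rightarrow> P1) \<Rightarrow> (complex \<times> complex) set \<Rightarrow> bool" where
  "holomorphic_P1_on G W \<longleftrightarrow>
     open W \<and>
     (\<forall>p\<in>W. \<exists>V g. p \<in> V \<and> V \<subseteq> W \<and> holomorphic2_on g V \<and>
        ((\<forall>q\<in>V. G q = Fin (g q)) \<or> (\<forall>q\<in>V. G q = chart_infty (g q))))"

definition holomorphic_P1xP1_on ::
    "(complex \<times> complex \<Rightarrow> P1 \<times> P1) \<Rightarrow> (complex \<times> complex) set \<Rightarrow> bool" where
  "holomorphic_P1xP1_on G W \<longleftrightarrow>
     holomorphic_P1_on (\<lambda>p. fst (G p)) W \<and> holomorphic_P1_on (\<lambda>p. snd (G p)) W"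

definition embed :: "complex \<times> complex \<Rightarrow> P1 \<times> P1" where
  "embed = (\<lambda>(x, y). (Fin x, Fin y))"


section \<open>The secant map\<close>

text \<open>
  Meromorphic functions on \<open>U\<close> are represented by \<open>f nicely_meromorphic_on U\<close>: no removable
  singularities, and the junk value \<open>0\<close> at poles.  Hence poles have to be excluded
  explicitly wherever the value of \<open>f\<close> is used.
\<close>

definition secant_generic :: "complex set \<Rightarrow> (complex \<Rightarrow> complex) \<Rightarrow> (complex \<times> complex) set" where
  "secant_generic U f =
     {(x, y). x \<in> U \<and> y \<in> U \<and> \<not> is_pole f x \<and> \<not> is_pole f y \<and> f x \<noteq> f y}"

definition secant_formula :: "(complex \<Rightarrow> complex) \<Rightarrow> complex \<times> complex \<Rightarrow> P1 \<times> P1" where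
  "secant_formula f = (\<lambda>(x, y). (Fin ((f x * y - f y * x) / (f x - f y)), Fin x))"

definition secant_extension ::
    "complex set \<Rightarrow> (complex \<Rightarrow> complex) \<Rightarrow> (complex \<times> complex) set \<Rightarrow>
     (complex \<times> complex \<Rightarrow> P1 \<times> P1) \<Rightarrow> bool" where
  "secant_extension U f W G \<longleftrightarrow>
     W \<subseteq> U \<times> U \<and> holomorphic_P1xP1_on G W \<and>
     (\<forall>p \<in> W \<inter> secant_generic U f. G p = secant_formula f p)"

text \<open>
  \<open>None\<close> marks the points where the map is indeterminate (or which lie outside \<open>U \<times> U\<close>).
  For \<open>f\<close> nonconstant meromorphic and \<open>U\<close> open and connected, \<open>secant_generic U f\<close> is dense
  in \<open>U \<times> U\<close>, so any two local extensions agree on their common domain and the description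
  by \<open>THE\<close> is proper.
\<close>

definition secant_map ::
    "complex set \<Rightarrow> (complex \<Rightarrow> complex) \<Rightarrow> complex \<times> complex \<Rightarrow> (P1 \<times> P1) option" where
  "secant_map U f p =
     (if \<exists>W G. p \<in> W \<and> secant_extension U f W G
      then Some (THE v. \<exists>W G. p \<in> W \<and> secant_extension U f W G \<and> G p = v)
      else None)"

text \<open>
  The last iterate may leave \<open>U \<times> U\<close> (and have infinite first coordinate); all preceding
  ones have to lie in the domain of the map, which is contained in \<open>U \<times> U\<close>.
\<close>

primrec secant_iterate ::
    "complex set \<Rightarrow> (complex \<Rightarrow> complex) \<Rightarrow> nat \<Rightarrow> complex \<times> complex \<Rightarrow> (P1 \<times> P1) option" where
  "secant_iterate U f 0 p = (if p \<in> U \<times> U then Some (embed p) else None)"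
| "secant_iterate U f (Suc n) p =
     (case secant_iterate U f n p of Some (Fin x, Fin y) \<Rightarrow> secant_map U f (x, y) | _ \<Rightarrow> None)"

definition secant_preimage ::
    "complex set \<Rightarrow> (complex \<Rightarrow> complex) \<Rightarrow> nat \<Rightarrow> (complex \<times> complex) set \<Rightarrow>
     (complex \<times> complex) set" where
  "secant_preimage U f n E = {p \<in> U \<times> U. \<exists>q\<in>E. secant_iterate U f n p = Some (embed q)}"

definition secant_orbit ::
    "complex set \<Rightarrow> (complex \<Rightarrow> complex) \<Rightarrow> complex \<times> complex \<Rightarrow> nat \<Rightarrow> complex \<times> complex" where
  "secant_orbit U f p n = (THE q. secant_iterate U f n p = Some (embed q))"

definition secant_basin ::
    "complex set \<Rightarrow> (complex \<Rightarrow> complex) \<Rightarrow> complex \<Rightarrow> (complex \<times> complex) set" where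
  "secant_basin U f z0 =
     {p \<in> U \<times> U. (\<forall>n. \<exists>q \<in> U \<times> U. secant_iterate U f n p = Some (embed q)) \<and>
                 secant_orbit U f p \<longlonglongrightarrow> (z0, z0)}"


section \<open>Potential function and Green's function\<close>

definition golden_ratio :: real where
  "golden_ratio = (1 + sqrt 5) / 2"

definition potential_approx ::
    "(complex \<times> complex \<Rightarrow> real) \<Rightarrow> complex set \<Rightarrow> (complex \<Rightarrow> complex) \<Rightarrow> complex \<Rightarrow>
     complex \<times> complex \<Rightarrow> nat \<Rightarrow> real" where
  "potential_approx N U f z0 p n =
     N (secant_orbit U f p n - (z0, z0)) powr (1 / golden_ratio ^ n)"

definition potential ::
    "(complex \<times> complex \<Rightarrow> real) \<Rightarrow> complex set \<Rightarrow> (complex \<Rightarrow> complex) \<Rightarrow> complex \<Rightarrow>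
     complex \<times> complex \<Rightarrow> real" where
  "potential N U f z0 p = lim (potential_approx N U f z0 p)"

definition green ::
    "(complex \<times> complex \<Rightarrow> real) \<Rightarrow> complex set \<Rightarrow> (complex \<Rightarrow> complex) \<Rightarrow> complex \<Rightarrow>
     complex \<times> complex \<Rightarrow> ereal" where
  "green N U f z0 p =
     (let h = potential N U f z0 p in if h = 0 then -\<infinity> else ereal (ln h))"

end

theory Submission
  imports Defs
begin

text \<open>
  Write \<open>X = x - z0\<close>, \<open>Y = y - z0\<close> and \<open>f = X g\<close>. Near \<open>(z0, z0)\<close> the secant map is
  \<open>(X, Y) \<mapsto> (X Y R, X)\<close>, where \<open>R\<close> is the quotient of the difference quotients of \<open>g\<close> and \<open>f\<close>, and
  \<open>R\<close> does not vanish because \<open>f''(z0) \<noteq> 0\<close>. Taking logarithms of absolute values gives a Fibonacci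
  recursion perturbed by the bounded pluriharmonic function \<open>ln \<bar>R\<bar>\<close>, so the \<open>\<phi>\<close>-eigencoordinate of the
  \<open>n\<close>-th iterate divided by \<open>\<phi>\<^sup>n\<close> converges to \<open>ln \<bar>X\<bar> + ln \<bar>Y\<bar> / \<phi>\<close> plus a uniformly convergent
  series of pluriharmonic functions, while the other eigencoordinate stays bounded. Every point of
  the basin is carried by a locally defined holomorphic iterate into this bidisk, and an orbit that
  meets \<open>X Y = 0\<close> there lands on the fixed point two steps later.
\<close>

section \<open>Holomorphic functions of two variables\<close>

text \<open>\<open>holomorphic2_on\<close> is Frechet differentiability with a complex linear
  derivative, so a uniform limit of such functions is not covered by definition: one-variable theory
  controls only the slices, and Osgood's lemma upgrades slicewise holomorphy plus continuity. The
  same lemma makes difference quotients holomorphic across the diagonal, where the secant formula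
  degenerates to 0/0. The condition on \<open>f''\<close> enters through the value f''(z0) / (2
  f'(z0)) of \<open>R\<close> at the fixed point: near it \<open>R\<close> stays close to a nonzero
  constant, so a single branch of its logarithm exists and is bounded along whole orbits. No such
  branch exists for \<open>X\<close> and \<open>Y\<close> on the punctured bidisk, which is why the
  holomorphic function with real part \<open>log h\<close> is produced only locally. The number phi
  is the root above 1 of t^2 = t + 1; the other root 1 - phi has modulus below 1, which bounds the
  second eigencoordinate. An arbitrary norm can be handled because \<open>X / Y\<close> tends to 0
  along every orbit, so the norm is comparable to the modulus of \<open>Y\<close>, and a bounded
  factor disappears under the exponent 1 / phi^n.\<close>

lemma holomorphic2_onD: "holomorphic2_on F W \<Longrightarrow> p \<in> W \<Longrightarrow> \<exists>a b. (F has_derivative (\<lambda>(u, v). a * u + b * v)) (at p)"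
  by (auto simp: holomorphic2_on_def)

lemma holomorphic2_on_open: "holomorphic2_on F W \<Longrightarrow> open W"
  by (auto simp: holomorphic2_on_def)

lemma holomorphic2_on_subset: "holomorphic2_on F W \<Longrightarrow> V \<subseteq> W \<Longrightarrow> open V \<Longrightarrow> holomorphic2_on F V"
  by (auto simp: holomorphic2_on_def)

lemma holomorphic2_on_isCont: "holomorphic2_on F W \<Longrightarrow> p \<in> W \<Longrightarrow> isCont F p"
  using holomorphic2_onD has_derivative_continuous by blast

lemma holomorphic2_on_continuous_on: "holomorphic2_on F W \<Longrightarrow> continuous_on W F"
  using holomorphic2_on_isCont continuous_at_imp_continuous_on by blast

text \<open>Chain rule for a scalar function after a pair of scalar functions. Sums, products and
  iterates all reduce to it.\<close>

lemma holomorphic2_on_compose_pair: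
  assumes F: "holomorphic2_on F W" and H: "holomorphic2_on H1 V" "holomorphic2_on H2 V"
    and sub: "\<And>p. p \<in> V \<Longrightarrow> (H1 p, H2 p) \<in> W"
  shows "holomorphic2_on (\<lambda>p. F (H1 p, H2 p)) V"
  unfolding holomorphic2_on_def
proof (intro conjI ballI)
  show "open V" using H by (rule_tac holomorphic2_on_open)
  fix p assume p: "p \<in> V"
  obtain a1 b1 where 1: "(H1 has_derivative (\<lambda>(u, v). a1 * u + b1 * v)) (at p)"
    using holomorphic2_onD[OF H(1) p] by auto
  obtain a2 b2 where 2: "(H2 has_derivative (\<lambda>(u, v). a2 * u + b2 * v)) (at p)"
    using holomorphic2_onD[OF H(2) p] by auto
  obtain a b where 3: "(F has_derivative (\<lambda>(u, v). a * u + b * v)) (at (H1 p, H2 p))"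
    using holomorphic2_onD[OF F sub[OF p]] by auto
  have "((\<lambda>p. (H1 p, H2 p)) has_derivative (\<lambda>h. ((\<lambda>(u, v). a1 * u + b1 * v) h, (\<lambda>(u, v). a2 * u + b2 * v) h))) (at p)"
    by (rule has_derivative_Pair[OF 1 2])
  from has_derivative_compose[OF this 3]
  have "((\<lambda>p. F (H1 p, H2 p)) has_derivative
     (\<lambda>(u, v). (a * a1 + b * a2) * u + (a * b1 + b * b2) * v)) (at p)"
    by (rule has_derivative_eq_rhs) (auto simp: fun_eq_iff algebra_simps)
  then show "\<exists>a b. ((\<lambda>p. F (H1 p, H2 p)) has_derivative (\<lambda>(u, v). a * u + b * v)) (at p)"
    by blast
qed

lemma holomorphic2_on_compose:
  assumes F: "holomorphic2_on F V" and h: "h holomorphic_on S" "open S"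
    and sub: "\<And>p. p \<in> V \<Longrightarrow> F p \<in> S"
  shows "holomorphic2_on (\<lambda>p. h (F p)) V"
  unfolding holomorphic2_on_def
proof (intro conjI ballI)
  show "open V" using F by (rule holomorphic2_on_open)
  fix p assume p: "p \<in> V"
  obtain a b where 1: "(F has_derivative (\<lambda>(u, v). a * u + b * v)) (at p)"
    using holomorphic2_onD[OF F p] by auto
  have "(h has_field_derivative deriv h (F p)) (at (F p))"
    using h sub[OF p] by (simp add: holomorphic_derivI)
  then have "(h has_derivative (*) (deriv h (F p))) (at (F p))"
    by (simp add: has_field_derivative_def)
  from has_derivative_compose[OF 1 this]
  have "((\<lambda>p. h (F p)) has_derivative
     (\<lambda>(u, v). (deriv h (F p) * a) * u + (deriv h (F p) * b) * v)) (at p)"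
    by (rule has_derivative_eq_rhs) (auto simp: fun_eq_iff algebra_simps)
  then show "\<exists>a b. ((\<lambda>p. h (F p)) has_derivative (\<lambda>(u, v). a * u + b * v)) (at p)"
    by blast
qed

lemma holomorphic2_on_const: "open V \<Longrightarrow> holomorphic2_on (\<lambda>p. c) V"
  unfolding holomorphic2_on_def
  by (auto intro!: exI[of _ 0] derivative_eq_intros simp: fun_eq_iff)

lemma holomorphic2_on_fst: "open V \<Longrightarrow> holomorphic2_on fst V"
  unfolding holomorphic2_on_def
proof (safe)
  fix a b :: complex
  show "\<exists>c d. (fst has_derivative (\<lambda>(u, v). c * u + d * v)) (at (a,b))"
    by (rule exI[of _ 1], rule exI[of _ 0])
      (rule has_derivative_eq_rhs[OF has_derivative_fst[OF has_derivative_ident]], auto simp: fun_eq_iff)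
qed

lemma holomorphic2_on_snd: "open V \<Longrightarrow> holomorphic2_on snd V"
  unfolding holomorphic2_on_def
proof (safe)
  fix a b :: complex
  show "\<exists>c d. (snd has_derivative (\<lambda>(u, v). c * u + d * v)) (at (a,b))"
    by (rule exI[of _ 0], rule exI[of _ 1])
      (rule has_derivative_eq_rhs[OF has_derivative_snd[OF has_derivative_ident]], auto simp: fun_eq_iff)
qed

lemma holomorphic2_on_add:
  assumes "holomorphic2_on F V" "holomorphic2_on G V"
  shows "holomorphic2_on (\<lambda>p. F p + G p) V"
proof -
  have "holomorphic2_on (\<lambda>p. fst p + snd p :: complex) UNIV"
    unfolding holomorphic2_on_def
    by (auto intro!: exI[of _ 1] derivative_eq_intros simp: fun_eq_iff)
  from holomorphic2_on_compose_pair[OF this assms] show ?thesis by simp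
qed

lemma holomorphic2_on_mult:
  assumes "holomorphic2_on F V" "holomorphic2_on G V"
  shows "holomorphic2_on (\<lambda>p. F p * G p) V"
proof -
  have "holomorphic2_on (\<lambda>p. fst p * snd p :: complex) UNIV"
    unfolding holomorphic2_on_def
  proof safe
    fix a b :: complex
    show "\<exists>c d. ((\<lambda>p. fst p * snd p) has_derivative (\<lambda>(u, v). c * u + d * v)) (at (a,b))"
      by (rule exI[of _ b], rule exI[of _ a]) (auto intro!: derivative_eq_intros simp: fun_eq_iff)
  qed auto
  from holomorphic2_on_compose_pair[OF this assms] show ?thesis by simp
qed

lemma holomorphic2_on_inverse:
  assumes "holomorphic2_on F V" "\<And>p. p \<in> V \<Longrightarrow> F p \<noteq> 0"
  shows "holomorphic2_on (\<lambda>p. inverse (F p)) V"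
  by (rule holomorphic2_on_compose[OF assms(1), of inverse "-{0}"])
    (use assms(2) in \<open>auto intro!: holomorphic_intros\<close>)

lemma holomorphic2_on_divide:
  assumes "holomorphic2_on F V" "holomorphic2_on G V" "\<And>p. p \<in> V \<Longrightarrow> G p \<noteq> 0"
  shows "holomorphic2_on (\<lambda>p. F p / G p) V"
  unfolding divide_inverse
  by (intro holomorphic2_on_mult holomorphic2_on_inverse assms)

lemma holomorphic2_on_sum:
  assumes "open V" "\<And>i. i \<in> I \<Longrightarrow> holomorphic2_on (F i) V"
  shows "holomorphic2_on (\<lambda>p. \<Sum>i\<in>I. F i p) V"
  using assms(2)
proof (induction I rule: infinite_finite_induct)
  case (insert x I)
  then show ?case by (auto intro: holomorphic2_on_add)
qed (auto intro: holomorphic2_on_const assms)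

lemma holomorphic2_on_fix_snd:
  assumes "holomorphic2_on F V" "(a, b) \<in> V"
  shows "(\<lambda>x. F (x, b)) field_differentiable (at a)"
proof -
  obtain c d where 1: "(F has_derivative (\<lambda>(u, v). c * u + d * v)) (at (a, b))"
    using holomorphic2_onD[OF assms] by auto
  have "((\<lambda>x. (x, b)) has_derivative (\<lambda>h. (h, 0))) (at a)"
    by (intro derivative_intros)
  from has_derivative_compose[OF this 1] have "((\<lambda>x. F (x, b)) has_field_derivative c) (at a)"
    unfolding has_field_derivative_def by (rule has_derivative_eq_rhs) auto
  then show ?thesis by (auto simp: field_differentiable_def)
qed

lemma holomorphic2_on_fix_fst:
  assumes "holomorphic2_on F V" "(a, b) \<in> V"
  shows "(\<lambda>y. F (a, y)) field_differentiable (at b)"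
proof -
  obtain c d where 1: "(F has_derivative (\<lambda>(u, v). c * u + d * v)) (at (a, b))"
    using holomorphic2_onD[OF assms] by auto
  have "((\<lambda>y. (a, y)) has_derivative (\<lambda>h. (0, h))) (at b)"
    by (intro derivative_intros)
  from has_derivative_compose[OF this 1] have "((\<lambda>y. F (a, y)) has_field_derivative d) (at b)"
    unfolding has_field_derivative_def by (rule has_derivative_eq_rhs) auto
  then show ?thesis by (auto simp: field_differentiable_def)
qed

lemma open_contains_bidisk:
  fixes W :: "(complex \<times> complex) set"
  assumes "open W" "(a, b) \<in> W"
  obtains r where "r > 0" "cball a r \<times> cball b r \<subseteq> W"
proof -
  obtain A B where AB: "open A" "open B" "a \<in> A" "b \<in> B" "A \<times> B \<subseteq> W"
    using open_prod_elim[OF assms] by (metis SigmaE2 mem_Sigma_iff)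
  obtain r1 r2 where "r1 > 0" "cball a r1 \<subseteq> A" "r2 > 0" "cball b r2 \<subseteq> B"
    using AB by (meson open_contains_cball)
  then show ?thesis
    by (intro that[of "min r1 r2"]) (use AB in force)+
qed

text \<open>Osgood's lemma. By Cauchy's inequality the partial derivatives inherit joint continuity
  from \<open>F\<close>.\<close>

lemma holomorphic2_on_Osgood:
  assumes W: "open W" and cont: "continuous_on W F"
    and hx: "\<And>a b. (a, b) \<in> W \<Longrightarrow> (\<lambda>x. F (x, b)) field_differentiable (at a)"
    and hy: "\<And>a b. (a, b) \<in> W \<Longrightarrow> (\<lambda>y. F (a, y)) field_differentiable (at b)"
  shows "holomorphic2_on F W"
  unfolding holomorphic2_on_def
proof (intro conjI ballI W)
  fix p assume "p \<in> W"
  then obtain a b where p: "p = (a, b)" and ab: "(a, b) \<in> W" by (cases p) auto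
  obtain r where r: "r > 0" and sub: "cball a r \<times> cball b r \<subseteq> W"
    using open_contains_bidisk[OF W ab] by blast
  define D where "D = (\<lambda>x y. deriv (\<lambda>y. F (x, y)) y)"
  have D: "((\<lambda>y. F (x, y)) has_field_derivative D x y) (at y)" if "x \<in> cball a r" "y \<in> cball b r" for x y
    using hy[of x y] sub that unfolding D_def
    by (metis DERIV_deriv_iff_field_differentiable mem_Sigma_iff subsetD)
  have hol: "(\<lambda>y. F (x, y)) holomorphic_on cball b r" if "x \<in> cball a r" for x
    using D[OF that] by (meson field_differentiable_at_within field_differentiable_def holomorphic_on_def)
  have ucont: "uniformly_continuous_on (cball a r \<times> cball b r) F"
    by (intro compact_uniformly_continuous continuous_on_subset[OF cont sub] compact_Times compact_cball)
  have 1: "((\<lambda>(x, y). D x y - D a y) \<longlongrightarrow> 0) (at (a, b) within ball a r \<times> ball b r)"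
  proof (rule tendstoI)
    fix e :: real assume e: "e > 0"
    obtain d where d: "d > 0" and dF: "\<And>x x'. x \<in> cball a r \<times> cball b r \<Longrightarrow> x' \<in> cball a r \<times> cball b r
        \<Longrightarrow> dist x' x < d \<Longrightarrow> dist (F x') (F x) < e * r / 4"
      using ucont e r unfolding uniformly_continuous_on_def
      by (metis divide_pos_pos mult_pos_pos zero_less_numeral)
    have "\<forall>\<^sub>F q in at (a, b) within ball a r \<times> ball b r. q \<in> ball a (min d r) \<times> ball b (r / 2)"
      by (rule eventually_at_topological[THEN iffD2], rule exI[of _ "ball a (min d r) \<times> ball b (r / 2)"])
        (use d r in \<open>auto intro: open_Times\<close>)
    then show "\<forall>\<^sub>F q in at (a, b) within ball a r \<times> ball b r. dist (case q of (x, y) \<Rightarrow> D x y - D a y) 0 < e"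
    proof (rule eventually_mono, safe)
      fix x y assume xy: "x \<in> ball a (min d r)" "y \<in> ball b (r / 2)"
      have sub2: "cball y (r / 2) \<subseteq> cball b r"
      proof
        fix w assume "w \<in> cball y (r / 2)"
        then show "w \<in> cball b r" using xy(2) dist_triangle[of b w y] by (auto simp: dist_commute)
      qed
      have xr: "x \<in> cball a r" "a \<in> cball a r" using xy r by auto
      have yr: "y \<in> cball b r" using xy r by auto
      have hh: "(\<lambda>w. F (x, w) - F (a, w)) holomorphic_on cball y (r / 2)"
        by (intro holomorphic_on_diff holomorphic_on_subset[OF hol sub2] xr)
      \<comment> \<open>Uniform continuity bounds the difference of the two slices by
        \<open>e * r / 4\<close> on the circle of radius \<open>r / 2\<close> about
        \<open>y\<close>, so the derivative is at most \<open>e / 2\<close>. Restricting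
        \<open>y\<close> to the half ball keeps that circle inside \<open>cball b r\<close>.\<close>
      have "norm ((deriv ^^ 1) (\<lambda>w. F (x, w) - F (a, w)) y) \<le> fact 1 * (e * r / 4) / (r / 2) ^ 1"
      proof (rule Cauchy_inequality)
        show "(\<lambda>w. F (x, w) - F (a, w)) holomorphic_on ball y (r / 2)"
          using hh by (rule holomorphic_on_subset) auto
        show "continuous_on (cball y (r / 2)) (\<lambda>w. F (x, w) - F (a, w))"
          using hh by (rule holomorphic_on_imp_continuous_on)
        fix w assume "cmod (y - w) = r / 2"
        then have "w \<in> cball b r" using sub2 by (auto simp: dist_norm)
        then have "dist (F (x, w)) (F (a, w)) < e * r / 4"
          using xr xy by (intro dF) (auto simp: dist_prod_def dist_commute)
        then show "cmod (F (x, w) - F (a, w)) \<le> e * r / 4" by (simp add: dist_norm)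
      qed (use r in auto)
      moreover have "deriv (\<lambda>w. F (x, w) - F (a, w)) y = D x y - D a y"
        by (intro DERIV_imp_deriv DERIV_diff D xr yr)
      ultimately show "dist (D x y - D a y) 0 < e" using r e by simp
    qed
  qed
  have 2: "((\<lambda>(x, y). D a y) \<longlongrightarrow> D a b) (at (a, b) within ball a r \<times> ball b r)"
  proof -
    have "deriv (\<lambda>y. F (a, y)) holomorphic_on ball b r"
      using hol[of a] r by (intro holomorphic_deriv holomorphic_on_subset[OF hol[of a]]) auto
    then have "continuous_on (ball b r) (D a)"
      unfolding D_def by (rule holomorphic_on_imp_continuous_on)
    then have "isCont (D a) b" using r by (simp add: continuous_on_eq_continuous_at)
    then have "((\<lambda>p. D a (snd p)) \<longlongrightarrow> D a (snd (a, b))) (at (a, b) within ball a r \<times> ball b r)"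
      by (intro isCont_tendsto_compose[where g = "D a"] tendsto_snd tendsto_ident_at) simp
    then show ?thesis by (simp add: case_prod_unfold)
  qed
  have 3: "((\<lambda>(x, y). D x y) \<longlongrightarrow> D a b) (at (a, b) within ball a r \<times> ball b r)"
    using tendsto_add[OF 1 2] by (simp add: case_prod_unfold)
  have "((\<lambda>(x, y). F (x, y)) has_derivative
      (\<lambda>(u, v). deriv (\<lambda>x. F (x, b)) a * u + blinfun_mult_right (D a b) v)) (at (a, b) within ball a r \<times> ball b r)"
  \<comment> \<open>This criterion asks for joint continuity of the \<open>y\<close>-derivative
    only; the \<open>x\<close>-derivative is needed just at \<open>(a, b)\<close>.\<close>
  proof (rule has_derivative_partialsI[where fy = "\<lambda>x y. blinfun_mult_right (D x y)"])
    have "((\<lambda>x. F (x, b)) has_field_derivative deriv (\<lambda>x. F (x, b)) a) (at a within ball a r)"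
      using hx[OF ab] by (simp add: DERIV_deriv_iff_field_differentiable has_field_derivative_at_within)
    then show "((\<lambda>x. F (x, b)) has_derivative (\<lambda>u. deriv (\<lambda>x. F (x, b)) a * u)) (at a within ball a r)"
      by (simp add: has_field_derivative_def)
    show "((\<lambda>y. F (x, y)) has_derivative blinfun_apply (blinfun_mult_right (D x y))) (at y within ball b r)"
      if "x \<in> ball a r" "y \<in> ball b r" for x y
    proof -
      have "((\<lambda>y. F (x, y)) has_field_derivative D x y) (at y within ball b r)"
        by (rule has_field_derivative_at_within[OF D]) (use that in auto)
      moreover have "blinfun_apply (blinfun_mult_right (D x y)) = (*) (D x y)"
        by (auto simp: fun_eq_iff)
      ultimately show ?thesis by (simp add: has_field_derivative_def)
    qed
    show "continuous (at (a, b) within ball a r \<times> ball b r) (\<lambda>(x, y). blinfun_mult_right (D x y))"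
      using bounded_linear.tendsto[OF bounded_linear_blinfun_mult_right 3]
      by (simp add: continuous_within case_prod_unfold)
  qed (use r in auto)
  then have "(F has_derivative (\<lambda>(u, v). deriv (\<lambda>x. F (x, b)) a * u + D a b * v)) (at (a, b))"
    using at_within_open[of "(a, b)" "ball a r \<times> ball b r"] r
    by (simp add: open_Times case_prod_unfold)
  then show "\<exists>a b. (F has_derivative (\<lambda>(u, v). a * u + b * v)) (at p)" unfolding p by blast
qed

lemma holomorphic2_on_open_preimage:
  assumes "holomorphic2_on H1 V" "holomorphic2_on H2 V" "open W"
  shows "open (V \<inter> (\<lambda>z. (H1 z, H2 z)) -` W)"
  by (rule continuous_open_preimage[OF continuous_on_Pair])
    (rule holomorphic2_on_continuous_on holomorphic2_on_open assms)+

text \<open>The limit is continuous, and each of its slices is a uniform limit of one-variable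
  holomorphic functions; Osgood's lemma does the rest.\<close>

lemma holomorphic2_on_uniform_limit:
  assumes V: "open V" and hol: "\<And>n. holomorphic2_on (f n) V"
    and lim: "uniform_limit V f g sequentially"
  shows "holomorphic2_on g V"
proof (rule holomorphic2_on_Osgood[OF V])
  show "continuous_on V g"
    by (rule uniform_limit_theorem[OF _ lim]) (auto intro: always_eventually holomorphic2_on_continuous_on hol)
  fix a b assume ab: "(a, b) \<in> V"
  obtain r where r: "r > 0" "cball a r \<times> cball b r \<subseteq> V"
    using open_contains_bidisk[OF V ab] by blast
  have in_V: "(x, y) \<in> V" if "x \<in> ball a r" "y \<in> ball b r" for x y
    using r(2) that by (meson ball_subset_cball mem_Sigma_iff subsetD)
  have aa: "a \<in> ball a r" "b \<in> ball b r" using r by auto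
  have "(\<lambda>x. g (x, b)) holomorphic_on ball a r"
  proof (rule holomorphic_uniform_sequence[where f = "\<lambda>n x. f n (x, b)"])
    show "(\<lambda>x. f n (x, b)) holomorphic_on ball a r" for n
      unfolding holomorphic_on_def
      using field_differentiable_at_within[OF holomorphic2_on_fix_snd[OF hol in_V]] aa by blast
    fix x assume "x \<in> ball a r"
    then obtain d where d: "d > 0" "cball x d \<subseteq> ball a r"
      by (meson open_ball open_contains_cball)
    have "uniform_limit (cball x d) (\<lambda>n x. f n (x, b)) (\<lambda>x. g (x, b)) sequentially"
      unfolding uniform_limit_iff
    proof safe
      fix e :: real assume "e > 0"
      with lim have "\<forall>\<^sub>F n in sequentially. \<forall>q\<in>V. dist (f n q) (g q) < e"
        by (auto simp: uniform_limit_iff)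
      then show "\<forall>\<^sub>F n in sequentially. \<forall>x\<in>cball x d. dist (f n (x, b)) (g (x, b)) < e"
        by (rule eventually_mono) (use d(2) in_V aa in blast)
    qed
    with d show "\<exists>d>0. cball x d \<subseteq> ball a r \<and>
        uniform_limit (cball x d) (\<lambda>n x. f n (x, b)) (\<lambda>x. g (x, b)) sequentially" by blast
  qed auto
  with r show "(\<lambda>x. g (x, b)) field_differentiable (at a)"
    by (simp add: holomorphic_on_imp_differentiable_at)
  have "(\<lambda>y. g (a, y)) holomorphic_on ball b r"
  proof (rule holomorphic_uniform_sequence[where f = "\<lambda>n y. f n (a, y)"])
    show "(\<lambda>y. f n (a, y)) holomorphic_on ball b r" for n
      unfolding holomorphic_on_def
      using field_differentiable_at_within[OF holomorphic2_on_fix_fst[OF hol in_V]] aa by blast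
    fix x assume "x \<in> ball b r"
    then obtain d where d: "d > 0" "cball x d \<subseteq> ball b r"
      by (meson open_ball open_contains_cball)
    have "uniform_limit (cball x d) (\<lambda>n y. f n (a, y)) (\<lambda>y. g (a, y)) sequentially"
      unfolding uniform_limit_iff
    proof safe
      fix e :: real assume "e > 0"
      with lim have "\<forall>\<^sub>F n in sequentially. \<forall>q\<in>V. dist (f n q) (g q) < e"
        by (auto simp: uniform_limit_iff)
      then show "\<forall>\<^sub>F n in sequentially. \<forall>y\<in>cball x d. dist (f n (a, y)) (g (a, y)) < e"
        by (rule eventually_mono) (use d(2) in_V aa in blast)
    qed
    with d show "\<exists>d>0. cball x d \<subseteq> ball b r \<and>
        uniform_limit (cball x d) (\<lambda>n y. f n (a, y)) (\<lambda>y. g (a, y)) sequentially" by blast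
  qed auto
  with r show "(\<lambda>y. g (a, y)) field_differentiable (at b)"
    by (simp add: holomorphic_on_imp_differentiable_at)
qed

lemma holomorphic2_on_suminf:
  assumes V: "open V" and hol: "\<And>k. holomorphic2_on (F k) V"
    and bound: "\<And>k p. p \<in> V \<Longrightarrow> norm (F k p) \<le> M k" and M: "summable M"
  shows "holomorphic2_on (\<lambda>p. \<Sum>k. F k p) V"
proof (rule holomorphic2_on_uniform_limit[OF V])
  show "uniform_limit V (\<lambda>n p. \<Sum>k<n. F k p) (\<lambda>p. \<Sum>k. F k p) sequentially"
    by (rule Weierstrass_m_test[OF bound M])
qed (intro holomorphic2_on_sum V hol)

section \<open>Difference quotients across the diagonal\<close>

definition diff_quot :: "(complex \<Rightarrow> complex) \<Rightarrow> complex \<times> complex \<Rightarrow> complex" where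
  "diff_quot g = (\<lambda>(x, y). if x = y then deriv g x else (g x - g y) / (x - y))"

lemma diff_quot_commute: "diff_quot g (x, y) = diff_quot g (y, x)"
  by (auto simp: diff_quot_def) (metis minus_diff_eq minus_divide_divide)

text \<open>Slices have a removable singularity, and symmetry reduces both variables to one case.
  The remaining issue for Osgood's lemma is joint continuity at diagonal points.\<close>

lemma holomorphic2_on_diff_quot:
  assumes g: "g holomorphic_on S" and S: "open S"
  shows "holomorphic2_on (diff_quot g) (S \<times> S)"
proof (rule holomorphic2_on_Osgood)
  show "open (S \<times> S)" using S by (intro open_Times)
  have 1: "(\<lambda>x. diff_quot g (x, b)) field_differentiable (at a)" if "a \<in> S" "b \<in> S" for a b
  proof -
    have "(\<lambda>x. if x = b then deriv g b else (g x - g b) / (x - b)) holomorphic_on S"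
      using g S that by (intro pole_lemma) (auto simp: interior_open)
    moreover have "(\<lambda>x. if x = b then deriv g b else (g x - g b) / (x - b)) = (\<lambda>x. diff_quot g (x, b))"
      by (auto simp: diff_quot_def fun_eq_iff)
    ultimately show ?thesis using S that by (simp add: holomorphic_on_imp_differentiable_at)
  qed
  then show "(\<lambda>x. diff_quot g (x, b)) field_differentiable (at a)" if "(a, b) \<in> S \<times> S" for a b
    using that by auto
  show "(\<lambda>y. diff_quot g (a, y)) field_differentiable (at b)" if "(a, b) \<in> S \<times> S" for a b
    using 1[of b a] that by (subst diff_quot_commute) auto
  have "isCont (diff_quot g) (a, b)" if ab: "a \<in> S" "b \<in> S" for a b
  proof (cases "a = b")
    case False
    have op: "open {q. fst q \<noteq> (snd q :: complex)}"
      by (intro open_Collect_neq continuous_intros)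
    have "\<forall>\<^sub>F q in nhds (a, b). (g (fst q) - g (snd q)) / (fst q - snd q) = diff_quot g q"
      using eventually_nhds_in_open[OF op, of "(a, b)"] False
      by (auto elim!: eventually_mono simp: diff_quot_def case_prod_unfold)
    moreover have "isCont (\<lambda>q. (g (fst q) - g (snd q)) / (fst q - snd q)) (a, b)"
    proof -
      have "isCont g a" "isCont g b"
        using g S ab holomorphic_on_imp_continuous_on continuous_on_eq_continuous_at by blast+
      then have "isCont (\<lambda>q. g (fst q)) (a, b)" "isCont (\<lambda>q. g (snd q)) (a, b)"
        using isCont_o2[OF isCont_fst[OF continuous_ident], of "(a,b)" g]
          isCont_o2[OF isCont_snd[OF continuous_ident], of "(a,b)" g] by auto
      then show ?thesis using False by (intro continuous_intros) auto
    qed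
    ultimately show ?thesis by (subst isCont_cong[OF eventually_mono]) (auto simp: eq_commute)
  next
    case True
    show ?thesis unfolding continuous_at_eps_delta
    proof (intro allI impI)
      fix e :: real assume e: "e > 0"
      have "continuous_on S (deriv g)"
        using g S by (intro holomorphic_on_imp_continuous_on holomorphic_deriv)
      then have "isCont (deriv g) a" using S ab continuous_on_eq_continuous_at by blast
      then obtain d1 where d1: "d1 > 0" "\<And>x. dist x a < d1 \<Longrightarrow> dist (deriv g x) (deriv g a) < e / 2"
        unfolding continuous_at_eps_delta by (meson e half_gt_zero)
      obtain d2 where d2: "d2 > 0" "ball a d2 \<subseteq> S" using S ab by (meson open_contains_ball)
      define d where "d = min d1 d2"
      have d: "d > 0" "ball a d \<subseteq> S" using d1 d2 by (auto simp: d_def)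
      have dd: "norm (deriv g x - deriv g a) \<le> e / 2" if "x \<in> ball a d" for x
        using d1(2)[of x] that by (auto simp: d_def dist_norm norm_minus_commute)
      have main: "norm (diff_quot g (x, y) - deriv g a) \<le> e / 2" if xy: "x \<in> ball a d" "y \<in> ball a d" for x y
      proof (cases "x = y")
        case True then show ?thesis using dd xy by (simp add: diff_quot_def)
      next
        case False
        \<comment> \<open>Mean value inequality for \<open>g z - deriv g a * z\<close>, whose
          derivative is at most \<open>e / 2\<close> on the convex ball. Dividing by
          \<open>x - y\<close> gives an error bound uniform in both points.\<close>
        have "norm ((g x - deriv g a * x) - (g y - deriv g a * y)) \<le> e / 2 * norm (x - y)"
        proof (rule field_differentiable_bound[OF convex_ball[of a d]])
          show "((\<lambda>z. g z - deriv g a * z) has_field_derivative (deriv g z - deriv g a)) (at z within ball a d)"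
            if "z \<in> ball a d" for z
          proof -
            have "(g has_field_derivative deriv g z) (at z)"
              using g S d that by (auto intro: holomorphic_derivI)
            then show ?thesis by (auto intro!: derivative_eq_intros intro: has_field_derivative_at_within)
          qed
        qed (use dd xy in auto)
        moreover have "diff_quot g (x, y) - deriv g a = ((g x - deriv g a * x) - (g y - deriv g a * y)) / (x - y)"
          using False by (simp add: diff_quot_def field_simps)
        ultimately show ?thesis using False
          by (simp only: norm_divide) (simp add: pos_divide_le_eq)
      qed
      show "\<exists>d>0. \<forall>q. dist q (a, b) < d \<longrightarrow> dist (diff_quot g q) (diff_quot g (a, b)) < e"
      proof (intro exI[of _ d] conjI d allI impI)
        fix q assume q: "dist q (a, b) < d"
        then have "fst q \<in> ball a d" "snd q \<in> ball a d"
          using dist_fst_le[of q "(a,b)"] dist_snd_le[of q "(a,b)"] True by (auto simp: dist_commute)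
        from main[OF this] e show "dist (diff_quot g q) (diff_quot g (a, b)) < e"
          by (simp add: dist_norm True) (simp add: diff_quot_def)
      qed
    qed
  qed
  then show "continuous_on (S \<times> S) (diff_quot g)"
    by (auto intro: continuous_at_imp_continuous_on)
qed

section \<open>The secant map and its iterates\<close>

text \<open>A continuous function that is nonzero at \<open>p\<close> stays nonzero nearby. This
  carries equations between chart expressions from a dense set to the point
  \<open>p\<close>.\<close>

lemma isCont_eq_0_of_frequently_eq_0:
  fixes h :: "'a::t2_space \<Rightarrow> 'b::{t1_space, zero}"
  assumes "isCont h p" "\<And>V. open V \<Longrightarrow> p \<in> V \<Longrightarrow> \<exists>q\<in>V. h q = 0"
  shows "h p = 0"
proof (rule ccontr)
  assume "h p \<noteq> 0"
  then have "\<exists>A. open A \<and> p \<in> A \<and> (\<forall>q\<in>A. h q \<in> - {0})"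
    using assms(1) unfolding continuous_at_open by (metis ComplI open_Compl closed_singleton singletonD)
  with assms(2) show False by blast
qed

lemma chart_infty_eq_iff [simp]: "chart_infty w = chart_infty w' \<longleftrightarrow> w = w'"
  by (auto simp: chart_infty_def)

lemma Fin_eq_chart_infty_iff: "Fin z = chart_infty w \<longleftrightarrow> z * w = 1"
  by (auto simp: chart_infty_def divide_simps)

text \<open>In equal charts agreement reads \<open>g = g'\<close>, in mixed charts
  \<open>g * g' = 1\<close>. Both are equations between continuous complex functions, so they pass
  to \<open>p\<close> without any topology on \<open>P1\<close>; the second also excludes a finite
  value meeting \<open>Infty\<close>.\<close>

lemma holomorphic_P1_unique:
  assumes G: "holomorphic_P1_on G W" "p \<in> W" and G': "holomorphic_P1_on G' W'" "p \<in> W'"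
    and freq: "\<And>V. open V \<Longrightarrow> p \<in> V \<Longrightarrow> \<exists>q\<in>V. G q = G' q"
  shows "G p = G' p"
proof -
  obtain V g where V: "p \<in> V" "holomorphic2_on g V"
    and g: "(\<forall>q\<in>V. G q = Fin (g q)) \<or> (\<forall>q\<in>V. G q = chart_infty (g q))"
    using G unfolding holomorphic_P1_on_def by blast
  obtain V' g' where V': "p \<in> V'" "holomorphic2_on g' V'"
    and g': "(\<forall>q\<in>V'. G' q = Fin (g' q)) \<or> (\<forall>q\<in>V'. G' q = chart_infty (g' q))"
    using G' unfolding holomorphic_P1_on_def by blast
  have cont [continuous_intros]: "isCont g p" "isCont g' p" using V V' by (auto intro: holomorphic2_on_isCont)
  have fr: "\<exists>q\<in>A. q \<in> V \<and> q \<in> V' \<and> G q = G' q" if "open A" "p \<in> A" for A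
    using freq[of "A \<inter> V \<inter> V'"] that V V' holomorphic2_on_open[OF V(2)] holomorphic2_on_open[OF V'(2)] by auto
  have 1: "g p = g' p" if "\<forall>q\<in>V \<inter> V'. G q = G' q \<longrightarrow> g q = g' q"
  proof -
    have "g p - g' p = 0"
    proof (rule isCont_eq_0_of_frequently_eq_0[where h = "\<lambda>q. g q - g' q"])
      show "\<exists>q\<in>A. g q - g' q = 0" if "open A" "p \<in> A" for A
        using fr[OF that] \<open>\<forall>q\<in>V \<inter> V'. _\<close> by auto
    qed (intro continuous_intros)
    then show ?thesis by simp
  qed
  have 2: "g p * g' p = 1" if "\<forall>q\<in>V \<inter> V'. G q = G' q \<longrightarrow> g q * g' q = 1"
  proof -
    have "g p * g' p - 1 = 0"
    proof (rule isCont_eq_0_of_frequently_eq_0[where h = "\<lambda>q. g q * g' q - 1"])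
      show "\<exists>q\<in>A. g q * g' q - 1 = 0" if "open A" "p \<in> A" for A
        using fr[OF that] \<open>\<forall>q\<in>V \<inter> V'. _\<close> by auto
    qed (intro continuous_intros)
    then show ?thesis by simp
  qed
  from g g' show ?thesis
  proof (elim disjE)
    assume "\<forall>q\<in>V. G q = Fin (g q)" "\<forall>q\<in>V'. G' q = Fin (g' q)"
    then show ?thesis using 1 V V' by simp
  next
    assume "\<forall>q\<in>V. G q = chart_infty (g q)" "\<forall>q\<in>V'. G' q = chart_infty (g' q)"
    then show ?thesis using 1 V V' by simp
  next
    assume "\<forall>q\<in>V. G q = Fin (g q)" "\<forall>q\<in>V'. G' q = chart_infty (g' q)"
    then show ?thesis using 2 V V' by (simp add: Fin_eq_chart_infty_iff)
  next
    assume "\<forall>q\<in>V. G q = chart_infty (g q)" "\<forall>q\<in>V'. G' q = Fin (g' q)"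
    then show ?thesis using 2 V V'
      by (metis Fin_eq_chart_infty_iff IntD1 IntD2 mult.commute)
  qed
qed

lemma holomorphic_P1_on_Fin:
  assumes "holomorphic2_on g W"
  shows "holomorphic_P1_on (\<lambda>q. Fin (g q)) W"
  unfolding holomorphic_P1_on_def using assms holomorphic2_on_open by blast

lemma embed_eq_iff [simp]: "embed q = embed q' \<longleftrightarrow> q = q'"
  by (auto simp: embed_def case_prod_unfold prod_eq_iff)

lemma embed_Pair [simp]: "embed (x, y) = (Fin x, Fin y)"
  by (simp add: embed_def)

lemma secant_orbit_eqI: "secant_iterate U f n p = Some (embed q) \<Longrightarrow> secant_orbit U f p n = q"
  unfolding secant_orbit_def by (rule the_equality) auto

locale secant =
  fixes U :: "complex set" and f :: "complex \<Rightarrow> complex"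
  assumes open_U: "open U" and connected_U: "connected U"
    and mero: "f nicely_meromorphic_on U" and nonconst: "\<not> f constant_on U"
begin

lemma eventually_not_pole_at:
  assumes "a \<in> U"
  shows "eventually (\<lambda>x. \<not> is_pole f x) (at a)"
proof (rule eventually_not_pole)
  show "isolated_singularity_at f a"
    using mero assms unfolding nicely_meromorphic_on_def by (auto simp: meromorphic_on_altdef)
qed

lemma eventually_neq_at:
  assumes "a \<in> U"
  shows "eventually (\<lambda>x. f x \<noteq> c) (at a)"
proof -
  have "\<not> (\<forall>x\<in>U. f x = c)" using nonconst by (auto simp: constant_on_def)
  then have "\<forall>\<^sub>\<approx>x\<in>U. f x \<noteq> c"
    using nicely_meromorphic_imp_constant_or_avoid[OF mero open_U connected_U, of c] by auto
  then show ?thesis using assms open_U by (auto simp: eventually_cosparse_open_eq)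
qed

text \<open>First \<open>y\<close> is chosen off the poles; then \<open>x\<close> avoids both the
  poles and the level set of \<open>f y\<close>, which is discrete since \<open>f\<close> is not
  constant.\<close>

lemma secant_generic_dense:
  assumes V: "open V" "p \<in> V" and p: "p \<in> U \<times> U"
  shows "\<exists>q\<in>V. q \<in> secant_generic U f"
proof -
  obtain a b where ab: "p = (a, b)" "a \<in> U" "b \<in> U" using p by auto
  obtain A B where AB: "open A" "open B" "a \<in> A" "b \<in> B" "A \<times> B \<subseteq> V"
    using open_prod_elim[OF V] ab by (metis SigmaE2)
  have in_nhd: "eventually (\<lambda>x. x \<in> A \<inter> U) (at a)" "eventually (\<lambda>x. x \<in> B \<inter> U) (at b)"
    by (rule eventually_at_in_open'; use AB ab open_U in auto)+
  from eventually_conj[OF in_nhd(2) eventually_not_pole_at[OF ab(3)]]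
  obtain y where y: "y \<in> B" "y \<in> U" "\<not> is_pole f y"
    using eventually_happens[of _ "at b"] by auto
  from eventually_conj[OF in_nhd(1) eventually_conj[OF eventually_not_pole_at[OF ab(2)] eventually_neq_at[OF ab(2), of "f y"]]]
  obtain x where x: "x \<in> A" "x \<in> U" "\<not> is_pole f x" "f x \<noteq> f y"
    using eventually_happens[of _ "at a"] by auto
  have "(x, y) \<in> secant_generic U f" using x y by (auto simp: secant_generic_def)
  then show ?thesis using x y AB by blast
qed

lemma secant_extension_unique:
  assumes 1: "secant_extension U f W G" "p \<in> W" and 2: "secant_extension U f W' G'" "p \<in> W'"
  shows "G p = G' p"
proof -
  have hol: "holomorphic_P1_on (\<lambda>p. fst (G p)) W" "holomorphic_P1_on (\<lambda>p. snd (G p)) W"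
    "holomorphic_P1_on (\<lambda>p. fst (G' p)) W'" "holomorphic_P1_on (\<lambda>p. snd (G' p)) W'"
    using 1(1) 2(1) unfolding secant_extension_def holomorphic_P1xP1_on_def by simp_all
  then have o: "open W" "open W'" unfolding holomorphic_P1_on_def by simp_all
  have val: "G q = secant_formula f q" "G' q = secant_formula f q"
    if "q \<in> W" "q \<in> W'" "q \<in> secant_generic U f" for q
    using 1(1) 2(1) that unfolding secant_extension_def by simp_all
  have p: "p \<in> U \<times> U" using 1 unfolding secant_extension_def by blast
  have *: "\<exists>q\<in>V. G q = G' q" if V: "open V" "p \<in> V" for V
  proof -
    obtain q where "q \<in> V \<inter> W \<inter> W'" "q \<in> secant_generic U f"
      using secant_generic_dense[OF _ _ p, of "V \<inter> W \<inter> W'"] o V 1(2) 2(2) by blast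
    then show ?thesis using val[of q] by (intro bexI[of _ q]) simp_all
  qed
  show ?thesis
  proof (rule prod_eqI)
    show "fst (G p) = fst (G' p)"
      by (rule holomorphic_P1_unique[OF hol(1) 1(2) hol(3) 2(2)]) (metis *)
    show "snd (G p) = snd (G' p)"
      by (rule holomorphic_P1_unique[OF hol(2) 1(2) hol(4) 2(2)]) (metis *)
  qed
qed

text \<open>Uniqueness makes the \<open>THE\<close> in \<open>secant_map\<close> independent of the
  extension, so exhibiting one extension computes the value.\<close>

lemma secant_map_eqI:
  assumes "secant_extension U f W G" "p \<in> W"
  shows "secant_map U f p = Some (G p)"
proof -
  have "(THE v. \<exists>W G. p \<in> W \<and> secant_extension U f W G \<and> G p = v) = G p"
    by (rule the_equality) (use assms secant_extension_unique in blast)+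
  then show ?thesis using assms unfolding secant_map_def by auto
qed

lemma secant_map_SomeE:
  assumes "secant_map U f p = Some v"
  obtains W G where "secant_extension U f W G" "p \<in> W" "G p = v"
proof -
  obtain W G where WG: "p \<in> W" "secant_extension U f W G"
    using assms unfolding secant_map_def by (auto split: if_splits)
  then show ?thesis using that secant_map_eqI[OF WG(2,1)] assms by simp
qed

text \<open>At a point with finite first value the map into the sphere can be replaced by a
  complex-valued holomorphic function on a neighborhood; this is what lets iterates be
  composed.\<close>

lemma secant_map_local:
  assumes "secant_map U f p = Some (Fin a, b)"
  obtains V g where "p \<in> V" "V \<subseteq> U \<times> U" "holomorphic2_on g V" "g p = a"
    "\<And>q. q \<in> V \<Longrightarrow> secant_map U f q = Some (Fin (g q), Fin (fst q))"
proof -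
  obtain W G where WG: "secant_extension U f W G" "p \<in> W" "G p = (Fin a, b)"
    using secant_map_SomeE[OF assms] by blast
  then have sub: "W \<subseteq> U \<times> U" and hol: "holomorphic_P1_on (\<lambda>p. fst (G p)) W" and oW: "open W"
    by (auto simp: secant_extension_def holomorphic_P1xP1_on_def holomorphic_P1_on_def)
  obtain V g where V: "p \<in> V" "V \<subseteq> W" "holomorphic2_on g V"
    and g: "(\<forall>q\<in>V. fst (G q) = Fin (g q)) \<or> (\<forall>q\<in>V. fst (G q) = chart_infty (g q))"
    using hol WG(2) unfolding holomorphic_P1_on_def by blast
  \<comment> \<open>Replacing the second component by the first coordinate gives another extension,
    so uniqueness forces that component to be \<open>Fin (fst q)\<close> on all of
    \<open>W\<close>.\<close>
  have ext: "secant_extension U f W (\<lambda>q. (fst (G q), Fin (fst q)))"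
    using WG(1) oW
    by (auto simp: secant_extension_def holomorphic_P1xP1_on_def secant_formula_def secant_generic_def
        intro: holomorphic_P1_on_Fin holomorphic2_on_fst)
  have eq: "secant_map U f q = Some (fst (G q), Fin (fst q))" if "q \<in> W" for q
    using secant_map_eqI[OF ext that] .
  from g show ?thesis
  proof
    assume *: "\<forall>q\<in>V. fst (G q) = Fin (g q)"
    have "fst (G p) = Fin (g p)" using * V by blast
    then have "g p = a" using WG(3) by simp
    moreover have "secant_map U f q = Some (Fin (g q), Fin (fst q))" if "q \<in> V" for q
      using eq[of q] * that V(2) by auto
    ultimately show ?thesis using that[of V g] V sub by auto
  next
    assume *: "\<forall>q\<in>V. fst (G q) = chart_infty (g q)"
    \<comment> \<open>In the chart at infinity a finite value means \<open>g p\<close> is nonzero;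
      off the zeros of \<open>g\<close> the chart can be inverted.\<close>
    define V' where "V' = V \<inter> g -` (-{0})"
    have "open V'" unfolding V'_def
      by (rule continuous_open_preimage[OF holomorphic2_on_continuous_on[OF V(3)] holomorphic2_on_open[OF V(3)]]) auto
    have "fst (G p) = chart_infty (g p)" using * V by blast
    then have "chart_infty (g p) = Fin a" using WG(3) by simp
    then have gp: "g p \<noteq> 0" "inverse (g p) = a" by (auto simp: chart_infty_def split: if_splits)
    show ?thesis
    proof (rule that[of V' "\<lambda>q. inverse (g q)"])
      show "holomorphic2_on (\<lambda>q. inverse (g q)) V'"
        by (intro holomorphic2_on_inverse holomorphic2_on_subset[OF V(3)] \<open>open V'\<close>) (auto simp: V'_def)
      show "secant_map U f q = Some (Fin (inverse (g q)), Fin (fst q))" if "q \<in> V'" for q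
        using eq[of q] * that V(2) by (auto simp: V'_def chart_infty_def)
    qed (use gp V sub in \<open>auto simp: V'_def\<close>)
  qed
qed

lemma secant_map_domain: "secant_map U f p = Some v \<Longrightarrow> p \<in> U \<times> U"
proof -
  assume "secant_map U f p = Some v"
  then obtain W G where "secant_extension U f W G" "p \<in> W" by (rule secant_map_SomeE)
  then show ?thesis unfolding secant_extension_def by blast
qed

lemma secant_iterate_SucE:
  assumes "secant_iterate U f (Suc n) p = Some v"
  obtains q where "secant_iterate U f n p = Some (embed q)" "secant_map U f q = Some v" "q \<in> U \<times> U"
proof -
  obtain x y where "secant_iterate U f n p = Some (Fin x, Fin y)" "secant_map U f (x, y) = Some v"
  proof (cases "secant_iterate U f n p")
    case (Some w)
    obtain s t where "w = (s, t)" by (cases w)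
    then show ?thesis using Some assms that by (cases s; cases t) auto
  qed (use assms in simp)
  then show ?thesis using that[of "(x, y)"] secant_map_domain[of "(x, y)" v] by simp
qed

lemma secant_iterate_Suc:
  "secant_iterate U f n p = Some (embed q) \<Longrightarrow> secant_iterate U f (Suc n) p = secant_map U f q"
  by (cases q) simp

text \<open>Membership of \<open>q\<close> in \<open>U \<times> U\<close> matters at
  \<open>m = 0\<close>, where the iterate of an outside point is \<open>None\<close>.\<close>

lemma secant_iterate_add:
  assumes "secant_iterate U f n p = Some (embed q)" "q \<in> U \<times> U"
  shows "secant_iterate U f (m + n) p = secant_iterate U f m q"
proof (induction m)
  case 0
  then show ?case using assms by (cases q) simp
next
  case (Suc m)
  then show ?case by simp
qed

text \<open>The domain of \<open>secant_map\<close> lies in \<open>U \<times> U\<close>, so every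
  iterate that is followed by another one is in \<open>U \<times> U\<close>. The last one may leave
  it, hence the strict \<open>k < n\<close>.\<close>

lemma secant_iterate_pred:
  assumes "secant_iterate U f n p = Some v" "k < n"
  shows "\<exists>q\<in>U \<times> U. secant_iterate U f k p = Some (embed q)"
  using assms
proof (induction n arbitrary: v)
  case (Suc n)
  obtain q where q: "secant_iterate U f n p = Some (embed q)" "q \<in> U \<times> U"
    using secant_iterate_SucE[OF Suc.prems(1)] .
  then show ?case using Suc by (cases "k = n") auto
qed auto

text \<open>Definedness with a finite value is an open condition, and the iterate is holomorphic
  there: the induction shrinks the neighborhood by the preimage of the one from
  \<open>secant_map_local\<close>.\<close>

lemma secant_iterate_local:
  assumes "secant_iterate U f n p = Some (embed q)"
  shows "\<exists>V H1 H2. p \<in> V \<and> V \<subseteq> U \<times> U \<and> holomorphic2_on H1 V \<and> holomorphic2_on H2 V \<and>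
    (\<forall>p'\<in>V. secant_iterate U f n p' = Some (embed (H1 p', H2 p')))"
  using assms
proof (induction n arbitrary: q)
  case 0
  have "open (U \<times> U)" using open_U by (intro open_Times)
  then show ?case using 0
    by (intro exI[of _ "U \<times> U"] exI[of _ fst] exI[of _ snd])
      (auto intro: holomorphic2_on_fst holomorphic2_on_snd split: if_splits)
next
  case (Suc n)
  obtain q' where q': "secant_iterate U f n p = Some (embed q')" "secant_map U f q' = Some (embed q)"
    using secant_iterate_SucE[OF Suc.prems] .
  obtain V H1 H2 where V: "p \<in> V" "V \<subseteq> U \<times> U" and H: "holomorphic2_on H1 V" "holomorphic2_on H2 V"
    and it: "\<And>p'. p' \<in> V \<Longrightarrow> secant_iterate U f n p' = Some (embed (H1 p', H2 p'))"
    using Suc.IH[OF q'(1)] by blast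
  have q'_eq: "q' = (H1 p, H2 p)" using it[OF V(1)] q'(1) by (simp del: embed_Pair)
  obtain a b where "embed q = (Fin a, b)" by (cases q) simp
  then obtain W g where W: "q' \<in> W" "holomorphic2_on g W"
    "\<And>z. z \<in> W \<Longrightarrow> secant_map U f z = Some (Fin (g z), Fin (fst z))"
    using secant_map_local[of q' a b] q'(2) by simp metis
  define V' where "V' = V \<inter> (\<lambda>z. (H1 z, H2 z)) -` W"
  have oV': "open V'" unfolding V'_def
    by (rule holomorphic2_on_open_preimage[OF H holomorphic2_on_open[OF W(2)]])
  have H': "holomorphic2_on H1 V'" "holomorphic2_on H2 V'"
    using H oV' by (auto intro: holomorphic2_on_subset simp: V'_def)
  have "secant_iterate U f (Suc n) p' = Some (embed (g (H1 p', H2 p'), H1 p'))" if "p' \<in> V'" for p'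
    using secant_iterate_Suc[OF it] W(3) that unfolding V'_def by auto
  moreover have "holomorphic2_on (\<lambda>z. g (H1 z, H2 z)) V'"
    by (rule holomorphic2_on_compose_pair[OF W(2) H']) (auto simp: V'_def)
  ultimately show ?case
    using V W(1) H'(1) q'_eq
    by (intro exI[of _ V'] exI[of _ "\<lambda>z. g (H1 z, H2 z)"] exI[of _ H1]) (auto simp: V'_def)
qed

end

section \<open>Normal form of the secant map at a simple root\<close>

text \<open>With \<open>f z = (z - z0) * g z\<close> the formula factors as \<open>X Y R\<close>,
  where \<open>R\<close> divides the difference quotient of \<open>g\<close> by that of
  \<open>f\<close>. On the diagonal point these are \<open>deriv g z0\<close>, half of the second
  derivative of \<open>f\<close>, and \<open>deriv f z0\<close>, so \<open>c = R (z0, z0)\<close> is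
  nonzero.\<close>

lemma (in secant) secant_map_near_simple_root:
  assumes z0: "z0 \<in> U" "\<not> is_pole f z0" "f z0 = 0" "deriv f z0 \<noteq> 0" "deriv (deriv f) z0 \<noteq> 0"
  obtains r R c where "r > 0" "ball z0 r \<subseteq> U" "holomorphic2_on R (ball z0 r \<times> ball z0 r)" "c \<noteq> 0"
    "\<And>q. q \<in> ball z0 r \<times> ball z0 r \<Longrightarrow> norm (R q / c - 1) < 1 / 2"
    "r * norm c \<le> 1 / 2"
    "\<And>q. q \<in> ball z0 r \<times> ball z0 r \<Longrightarrow>
       secant_map U f q = Some (Fin (z0 + (fst q - z0) * (snd q - z0) * R q), Fin (fst q))"
proof -
  have "f analytic_on {z0}"
    using nicely_meromorphic_on_imp_analytic_at[OF mero] z0 by blast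
  then obtain s0 where s0: "s0 > 0" "f holomorphic_on ball z0 s0"
    by (auto simp: analytic_on_def)
  obtain s1 where s1: "s1 > 0" "ball z0 s1 \<subseteq> U" using open_U z0 by (meson open_contains_ball)
  define s where "s = min s0 s1"
  define B where "B = ball z0 s"
  have B: "open B" "z0 \<in> B" "B \<subseteq> U" and f: "f holomorphic_on B"
    using s0 s1 by (auto simp: s_def B_def intro: holomorphic_on_subset)
  define g where "g = (\<lambda>z. if z = z0 then deriv f z0 else (f z - f z0) / (z - z0))"
  have g: "g holomorphic_on B"
    unfolding g_def using f B by (intro pole_lemma) (auto simp: interior_open)
  have fg: "f z = (z - z0) * g z" for z using z0 by (simp add: g_def)
  have g': "(g has_field_derivative deriv g z) (at z)" if "z \<in> B" for z
    using g B that by (auto intro: holomorphic_derivI)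
  have "deriv f z = g z + (z - z0) * deriv g z" if "z \<in> B" for z
  proof (rule DERIV_imp_deriv)
    have "((\<lambda>z. (z - z0) * g z) has_field_derivative g z + (z - z0) * deriv g z) (at z)"
      by (auto intro!: derivative_eq_intros g' that simp: algebra_simps)
    then show "(f has_field_derivative g z + (z - z0) * deriv g z) (at z)"
      by (simp add: fg[abs_def])
  qed
  then have "\<forall>\<^sub>F z in nhds z0. deriv f z = g z + (z - z0) * deriv g z"
    using eventually_nhds_in_open[OF B(1,2)] by (auto elim: eventually_mono)
  then have "deriv (deriv f) z0 = deriv (\<lambda>z. g z + (z - z0) * deriv g z) z0"
    by (rule deriv_cong_ev) simp
  also have "\<dots> = 2 * deriv g z0"
  proof (rule DERIV_imp_deriv)
    have "(deriv g has_field_derivative deriv (deriv g) z0) (at z0)"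
      using g B by (auto intro: holomorphic_derivI holomorphic_deriv)
    then show "((\<lambda>z. g z + (z - z0) * deriv g z) has_field_derivative 2 * deriv g z0) (at z0)"
      using g'[OF B(2)] by (auto intro!: derivative_eq_intros)
  qed
  finally have g'0: "deriv g z0 \<noteq> 0" using z0 by simp
  define P where "P = diff_quot g"
  define Q where "Q = diff_quot f"
  have P: "holomorphic2_on P (B \<times> B)" and Q: "holomorphic2_on Q (B \<times> B)"
    unfolding P_def Q_def using f g B by (auto intro: holomorphic2_on_diff_quot)
  define V1 where "V1 = (B \<times> B) \<inter> Q -` (- {0})"
  have oV1: "open V1" unfolding V1_def
    by (rule continuous_open_preimage[OF holomorphic2_on_continuous_on[OF Q] holomorphic2_on_open[OF Q]]) auto
  have zV1: "(z0, z0) \<in> V1" using z0 B by (simp add: V1_def Q_def diff_quot_def)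
  define R where "R = (\<lambda>q. P q / Q q)"
  have R: "holomorphic2_on R V1"
    unfolding R_def
    by (intro holomorphic2_on_divide holomorphic2_on_subset[OF P] holomorphic2_on_subset[OF Q] oV1)
      (auto simp: V1_def)
  define c where "c = R (z0, z0)"
  have c: "c \<noteq> 0" using g'0 z0 by (simp add: c_def R_def P_def Q_def diff_quot_def)
  \<comment> \<open>The radius \<open>norm c / 2\<close> is the bound 1/2 on
    \<open>R q / c - 1\<close> after division by \<open>c\<close>.\<close>
  define V2 where "V2 = V1 \<inter> R -` ball c (norm c / 2)"
  have oV2: "open V2" unfolding V2_def
    by (rule continuous_open_preimage[OF holomorphic2_on_continuous_on[OF R] oV1]) auto
  have "(z0, z0) \<in> V2" using zV1 c by (simp add: V2_def c_def)
  then obtain r0 where r0: "r0 > 0" "cball z0 r0 \<times> cball z0 r0 \<subseteq> V2"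
    using open_contains_bidisk[OF oV2] by blast
  \<comment> \<open>The second entry ensures \<open>r * norm c \<le> 1 / 2\<close>, the source of
    contraction.\<close>
  define r where "r = min r0 (1 / (2 * norm c))"
  define D where "D = ball z0 r \<times> ball z0 r"
  have r: "r > 0" "r \<le> r0" "r * norm c \<le> 1 / 2"
    using r0 c by (auto simp: r_def min_mult_distrib_right field_simps min_def)
  have "ball z0 r \<subseteq> cball z0 r0" using r(2) by auto
  then have DV: "D \<subseteq> V2" using r0(2) unfolding D_def by blast
  have DV1: "D \<subseteq> V1" using DV by (auto simp: V2_def)
  have oD: "open D" by (simp add: D_def open_Times)
  have RD: "holomorphic2_on R D" using R DV1 oD by (rule holomorphic2_on_subset)
  have DB: "D \<subseteq> B \<times> B" using DV1 by (auto simp: V1_def)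
  have rB: "ball z0 r \<subseteq> B" using DB r(1) unfolding D_def by blast
  define G where "G = (\<lambda>q. (Fin (z0 + (fst q - z0) * (snd q - z0) * R q), Fin (fst q)))"
  have "secant_extension U f D G"
    unfolding secant_extension_def holomorphic_P1xP1_on_def
  proof (intro conjI ballI)
    show "D \<subseteq> U \<times> U" using DB B by blast
    have "holomorphic2_on (\<lambda>q. z0 + (fst q + (- z0)) * (snd q + (- z0)) * R q) D"
      by (intro holomorphic2_on_add holomorphic2_on_mult holomorphic2_on_const holomorphic2_on_fst
          holomorphic2_on_snd oD RD)
    then show "holomorphic_P1_on (\<lambda>p. fst (G p)) D"
      unfolding G_def by (auto intro: holomorphic_P1_on_Fin)
    show "holomorphic_P1_on (\<lambda>p. snd (G p)) D"
      unfolding G_def by (auto intro: holomorphic_P1_on_Fin holomorphic2_on_fst oD)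
    fix q assume q: "q \<in> D \<inter> secant_generic U f"
    obtain x y where xy: "q = (x, y)" by (cases q)
    have "f x \<noteq> f y" using q xy by (auto simp: secant_generic_def)
    then have "x \<noteq> y" by auto
    have "P (x, y) * (x - y) = g x - g y" "Q (x, y) * (x - y) = f x - f y"
      using \<open>x \<noteq> y\<close> by (auto simp: P_def Q_def diff_quot_def)
    moreover have "Q (x, y) \<noteq> 0" using q xy DV1 by (auto simp: V1_def)
    ultimately have R_eq: "R (x, y) * (f x - f y) = g x - g y"
      by (simp add: R_def) (metis mult.assoc nonzero_eq_divide_eq times_divide_eq_left mult.commute)
    \<comment> \<open>Writing \<open>y = z0 + Y\<close> and \<open>x = z0 + X\<close> splits off
      \<open>z0 * (f x - f y)\<close>; the rest has the common factor \<open>X Y\<close> because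
      \<open>f\<close> is \<open>X\<close> times \<open>g\<close>.\<close>
    have "f x * y - f y * x = z0 * (f x - f y) + (x - z0) * (y - z0) * (g x - g y)"
      by (simp add: fg algebra_simps)
    also have "\<dots> = (z0 + (x - z0) * (y - z0) * R (x, y)) * (f x - f y)"
      unfolding R_eq[symmetric] by (simp add: algebra_simps)
    finally have "(f x * y - f y * x) / (f x - f y) = z0 + (x - z0) * (y - z0) * R (x, y)"
      using \<open>f x \<noteq> f y\<close> by (simp add: nonzero_divide_eq_eq)
    then show "G q = secant_formula f q"
      by (simp add: G_def secant_formula_def xy)
  qed
  then have "secant_map U f q = Some (G q)" if "q \<in> D" for q
    using that by (rule secant_map_eqI)
  moreover have "norm (R q / c - 1) < 1 / 2" if "q \<in> D" for q
  proof -
    have "norm (R q - c) < norm c / 2"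
      using DV that by (auto simp: V2_def dist_norm norm_minus_commute)
    moreover have "R q / c - 1 = (R q - c) / c" using c by (simp add: field_simps)
    ultimately show ?thesis using c by (simp add: norm_divide field_simps)
  qed
  ultimately show ?thesis
    using that[of r R c] r c RD rB B(3) unfolding D_def G_def by blast
qed

section \<open>Dynamics near the superattracting fixed point\<close>

text \<open>The closed disk of radius 1/2 about 1 is compact and lies in the right half-plane, away
  from the branch cut.\<close>

lemma norm_Ln_bound:
  obtains B where "\<And>w. norm (w - 1) < 1 / 2 \<Longrightarrow> norm (Ln w) \<le> B"
proof -
  have "compact (Ln ` cball 1 (1 / 2))"
  proof (intro compact_continuous_image continuous_on_Ln compact_cball)
    fix w :: complex assume "w \<in> cball 1 (1 / 2)"
    then have "\<bar>1 - Re w\<bar> \<le> 1 / 2" using abs_Re_le_cmod[of "1 - w"] by (auto simp: dist_norm)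
    then show "w \<notin> \<real>\<^sub>\<le>\<^sub>0" by (auto simp: complex_nonpos_Reals_iff)
  qed
  then obtain B where "\<forall>w\<in>Ln ` cball 1 (1 / 2). norm w \<le> B"
    using compact_imp_bounded bounded_iff by metis
  then show ?thesis by (intro that[of B]) (auto simp: dist_norm norm_minus_commute)
qed

lemma golden_ratio_gt_1: "golden_ratio > 1"
proof -
  have "sqrt 5 > 1" by simp
  then show ?thesis by (simp add: golden_ratio_def)
qed

lemma golden_ratio_lt_2: "golden_ratio < 2"
proof -
  have "sqrt 5 < sqrt 9" by (intro real_sqrt_less_mono) simp
  also have "sqrt 9 = sqrt (3^2)" by simp
  finally have "sqrt 5 < 3" by simp
  then show ?thesis by (simp add: golden_ratio_def)
qed

lemma golden_ratio_square: "golden_ratio * golden_ratio = golden_ratio + 1"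
  by (simp add: golden_ratio_def field_simps)

text \<open>The dynamics is studied for the normal form alone, without \<open>f\<close>. Together
  the two bounds give \<open>norm (Y * R) \<le> 3 / 4\<close>, since 3/4 is 3/2 times 1/2.\<close>

locale secant_germ =
  fixes z0 :: complex and r :: real and R :: "complex \<times> complex \<Rightarrow> complex" and c :: complex
  assumes r_pos: "r > 0" and hol_R: "holomorphic2_on R (ball z0 r \<times> ball z0 r)" and c_nz: "c \<noteq> 0"
    and R_close: "\<And>q. q \<in> ball z0 r \<times> ball z0 r \<Longrightarrow> norm (R q / c - 1) < 1 / 2"
    and small: "r * norm c \<le> 1 / 2"
begin

definition bidisk :: "(complex \<times> complex) set" where
  "bidisk = ball z0 r \<times> ball z0 r"

definition punctured :: "(complex \<times> complex) set" where
  "punctured = {q \<in> bidisk. fst q \<noteq> z0 \<and> snd q \<noteq> z0}"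

definition step :: "complex \<times> complex \<Rightarrow> complex \<times> complex" where
  "step q = (z0 + (fst q - z0) * (snd q - z0) * R q, fst q)"

text \<open>A branch of log \<open>R\<close>. Dividing by \<open>c\<close> first keeps the argument
  in the right half-plane, whereas \<open>c\<close> itself may lie on the cut of
  \<open>Ln\<close>.\<close>

definition logR :: "complex \<times> complex \<Rightarrow> complex" where
  "logR q = Ln (R q / c) + Ln c"

lemma open_bidisk: "open bidisk"
  by (simp add: bidisk_def open_Times)

lemma open_punctured: "open punctured"
proof -
  have "punctured = (ball z0 r - {z0}) \<times> (ball z0 r - {z0})"
    by (auto simp: punctured_def bidisk_def)
  then show ?thesis by (simp add: open_Times open_delete)
qed

lemma R_nz: "q \<in> bidisk \<Longrightarrow> R q \<noteq> 0"
  using R_close[of q] by (auto simp: bidisk_def)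

lemma R_bound:
  assumes "q \<in> bidisk"
  shows "norm (R q) \<le> 3 / 2 * norm c"
proof -
  have "norm (R q / c) \<le> norm (R q / c - 1) + norm (1 :: complex)"
    using norm_triangle_ineq[of "R q / c - 1" 1] by simp
  also have "\<dots> \<le> 3 / 2" using R_close[of q] assms by (simp add: bidisk_def)
  finally show ?thesis using c_nz by (simp add: norm_divide field_simps)
qed

lemma hol_logR: "holomorphic2_on logR bidisk"
proof -
  have "holomorphic2_on (\<lambda>q. R q / c) bidisk"
    using hol_R c_nz open_bidisk
    by (intro holomorphic2_on_divide holomorphic2_on_const) (auto simp: bidisk_def)
  then have "holomorphic2_on (\<lambda>q. Ln (R q / c)) bidisk"
  proof (rule holomorphic2_on_compose)
    show "Ln holomorphic_on - \<real>\<^sub>\<le>\<^sub>0" by (intro holomorphic_intros) auto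
    fix q assume "q \<in> bidisk"
    then have "norm (1 - R q / c) < 1 / 2"
      using R_close[of q] by (simp add: bidisk_def norm_minus_commute)
    then have "\<bar>Re (1 - R q / c)\<bar> < 1 / 2" using abs_Re_le_cmod[of "1 - R q / c"] by linarith
    then have "Re (R q / c) > 0" by (simp add: abs_if split: if_splits)
    then show "R q / c \<in> - \<real>\<^sub>\<le>\<^sub>0" by (auto simp: complex_nonpos_Reals_iff)
  qed (auto intro: open_Compl)
  then show ?thesis unfolding logR_def[abs_def]
    by (intro holomorphic2_on_add holomorphic2_on_const open_bidisk)
qed

lemma Re_logR: "q \<in> bidisk \<Longrightarrow> Re (logR q) = ln (norm (R q))"
  using R_nz[of q] c_nz by (simp add: logR_def norm_divide ln_div)

lemma logR_bound:
  obtains B where "B \<ge> 0" "\<And>q. q \<in> bidisk \<Longrightarrow> norm (logR q) \<le> B"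
proof -
  obtain B where B: "\<And>w. norm (w - 1) < 1 / 2 \<Longrightarrow> norm (Ln w) \<le> B"
    using norm_Ln_bound by blast
  show ?thesis
  proof (rule that[of "\<bar>B\<bar> + norm (Ln c)"])
    fix q assume "q \<in> bidisk"
    then have "norm (Ln (R q / c)) \<le> \<bar>B\<bar>" using B[OF R_close] by (fastforce simp: bidisk_def)
    then show "norm (logR q) \<le> \<bar>B\<bar> + norm (Ln c)"
      unfolding logR_def using norm_triangle_ineq[of "Ln (R q / c)" "Ln c"] by linarith
  qed auto
qed

lemma norm_fst_step:
  assumes "q \<in> bidisk"
  shows "norm (fst (step q) - z0) \<le> 3 / 4 * norm (fst q - z0)"
proof -
  have "norm (snd q - z0) * norm (R q) \<le> r * (3 / 2 * norm c)"
    using R_bound[OF assms] assms r_pos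
    by (intro mult_mono) (auto simp: bidisk_def dist_norm norm_minus_commute)
  also have "\<dots> \<le> 3 / 4" using small by simp
  finally have "norm (fst q - z0) * (norm (snd q - z0) * norm (R q)) \<le> norm (fst q - z0) * (3 / 4)"
    by (intro mult_left_mono) auto
  then show ?thesis by (simp add: step_def norm_mult mult_ac)
qed

lemma step_bidisk: "q \<in> bidisk \<Longrightarrow> step q \<in> bidisk"
proof -
  assume q: "q \<in> bidisk"
  have "norm (fst (step q) - z0) \<le> norm (fst q - z0)"
    using norm_fst_step[OF q] norm_ge_zero[of "fst q - z0"] by linarith
  then show ?thesis using q by (auto simp: bidisk_def dist_norm norm_minus_commute step_def)
qed

lemma step_punctured: "q \<in> punctured \<Longrightarrow> step q \<in> punctured"
  using step_bidisk[of q] R_nz[of q] by (auto simp: punctured_def step_def)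

lemma iter_bidisk: "q \<in> bidisk \<Longrightarrow> (step ^^ n) q \<in> bidisk"
  by (induction n) (auto intro: step_bidisk)

lemma iter_punctured: "q \<in> punctured \<Longrightarrow> (step ^^ n) q \<in> punctured"
  by (induction n) (auto intro: step_punctured)

lemma step_center: "step (z0, z0) = (z0, z0)"
  by (simp add: step_def)

text \<open>If \<open>X = 0\<close>, one step reaches the center. If \<open>Y = 0\<close>, one step
  makes the first coordinate \<open>z0\<close> and the second step finishes; hence the shift by
  2.\<close>

lemma iter_not_punctured:
  assumes "q \<in> bidisk" "q \<notin> punctured"
  shows "(step ^^ (n + 2)) q = (z0, z0)"
proof (induction n)
  case 0
  then show ?case using assms by (auto simp: punctured_def step_def numeral_2_eq_2)
qed (simp add: step_center)

lemma hol_iter: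
  "holomorphic2_on (\<lambda>q. fst ((step ^^ n) q)) bidisk \<and> holomorphic2_on (\<lambda>q. snd ((step ^^ n) q)) bidisk"
proof (induction n)
  case 0
  then show ?case by (auto intro: holomorphic2_on_fst holomorphic2_on_snd open_bidisk)
next
  case (Suc n)
  have "holomorphic2_on (\<lambda>q. z0 + (fst q + - z0) * (snd q + - z0) * R q) bidisk"
    using hol_R open_bidisk
    by (intro holomorphic2_on_add holomorphic2_on_mult holomorphic2_on_const holomorphic2_on_fst
        holomorphic2_on_snd) (auto simp: bidisk_def)
  then have "holomorphic2_on (\<lambda>q. fst (step q)) bidisk" by (simp add: step_def)
  from holomorphic2_on_compose_pair[OF this, of "\<lambda>q. fst ((step ^^ n) q)" _ "\<lambda>q. snd ((step ^^ n) q)"] Suc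
  have "holomorphic2_on (\<lambda>q. fst ((step ^^ Suc n) q)) bidisk" by (simp add: iter_bidisk)
  moreover have "(\<lambda>q. snd ((step ^^ Suc n) q)) = (\<lambda>q. fst ((step ^^ n) q))"
    by (simp add: step_def fun_eq_iff)
  ultimately show ?case using Suc by simp
qed

lemma norm_iter_fst: "q \<in> bidisk \<Longrightarrow> norm (fst ((step ^^ n) q) - z0) \<le> (3 / 4) ^ n * r"
proof (induction n)
  case 0
  then show ?case by (auto simp: bidisk_def dist_norm norm_minus_commute)
next
  case (Suc n)
  have "norm (fst ((step ^^ Suc n) q) - z0) \<le> 3 / 4 * norm (fst ((step ^^ n) q) - z0)"
    using norm_fst_step[OF iter_bidisk[OF Suc.prems]] by simp
  with Suc show ?case by simp
qed

lemma iter_fst_tendsto: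
  assumes "q \<in> bidisk"
  shows "(\<lambda>n. fst ((step ^^ n) q)) \<longlonglongrightarrow> z0"
proof -
  have "(\<lambda>n. (3 / 4) ^ n * r) \<longlonglongrightarrow> 0"
    by (intro tendsto_mult_left_zero LIMSEQ_realpow_zero) auto
  then have "(\<lambda>n. fst ((step ^^ n) q) - z0) \<longlonglongrightarrow> 0"
    by (rule Lim_null_comparison[rotated]) (use norm_iter_fst[OF assms] in auto)
  then show ?thesis by (rule LIM_zero_cancel)
qed

lemma iter_snd_tendsto:
  assumes "q \<in> bidisk"
  shows "(\<lambda>n. snd ((step ^^ n) q)) \<longlonglongrightarrow> z0"
  by (rule LIMSEQ_imp_Suc) (use iter_fst_tendsto[OF assms] in \<open>simp add: step_def\<close>)

lemma iter_tendsto: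
  assumes "q \<in> bidisk"
  shows "(\<lambda>n. (step ^^ n) q) \<longlonglongrightarrow> (z0, z0)"
  using tendsto_Pair[OF iter_fst_tendsto[OF assms] iter_snd_tendsto[OF assms]] by simp

text \<open>In the coordinates \<open>ln \<bar>x - z0\<bar>\<close>, \<open>ln \<bar>y - z0\<bar>\<close> the map is the Fibonacci recursion up to
  the bounded term \<open>ln \<bar>R\<bar>\<close>. The functions \<open>expanding\<close> and \<open>contracting\<close> are the eigencoordinates
  for the eigenvalues \<open>\<phi>\<close> and \<open>1 - \<phi> = - 1 / \<phi>\<close>.\<close>

definition expanding :: "complex \<times> complex \<Rightarrow> real" where
  "expanding q = ln (norm (fst q - z0)) + (golden_ratio - 1) * ln (norm (snd q - z0))"

definition contracting :: "complex \<times> complex \<Rightarrow> real" where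
  "contracting q = ln (norm (fst q - z0)) - golden_ratio * ln (norm (snd q - z0))"

lemma ln_fst_step:
  assumes "q \<in> punctured"
  shows "ln (norm (fst (step q) - z0)) =
    ln (norm (fst q - z0)) + ln (norm (snd q - z0)) + Re (logR q)"
  using assms R_nz[of q] by (simp add: punctured_def step_def norm_mult ln_mult Re_logR)

text \<open>After a step the coefficient of \<open>ln \<bar>X\<bar>\<close> is phi and that of
  \<open>ln \<bar>Y\<bar>\<close> is 1 = phi (phi - 1). The perturbation has weight 1 because it
  enters only through the first coordinate.\<close>

lemma expanding_step:
  assumes "q \<in> punctured"
  shows "expanding (step q) = golden_ratio * expanding q + Re (logR q)"
proof -
  have [simp]: "golden_ratio * (golden_ratio * t) = (golden_ratio + 1) * t" for t
    by (simp add: golden_ratio_square flip: mult.assoc)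
  have "snd (step q) = fst q" by (simp add: step_def)
  then show ?thesis
    unfolding expanding_def ln_fst_step[OF assms] by (simp add: algebra_simps)
qed

lemma contracting_step:
  assumes "q \<in> punctured"
  shows "contracting (step q) = (1 - golden_ratio) * contracting q + Re (logR q)"
proof -
  have [simp]: "golden_ratio * (golden_ratio * t) = (golden_ratio + 1) * t" for t
    by (simp add: golden_ratio_square flip: mult.assoc)
  have "snd (step q) = fst q" by (simp add: step_def)
  then show ?thesis
    unfolding contracting_def ln_fst_step[OF assms] by (simp add: algebra_simps)
qed

text \<open>Dividing \<open>expanding_step\<close> by \<open>golden_ratio ^ Suc k\<close> and
  telescoping produces these terms; step \<open>k\<close> already carries the power
  \<open>Suc k\<close>.\<close>

definition correction :: "complex \<times> complex \<Rightarrow> complex" where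
  "correction q = (\<Sum>k. logR ((step ^^ k) q) / of_real (golden_ratio ^ Suc k))"

text \<open>Up to a constant factor this is the Green's function of the germ: the limit of
  \<open>expanding\<close> along the orbit divided by phi^n, which a step multiplies by phi.\<close>

definition escape :: "complex \<times> complex \<Rightarrow> real" where
  "escape q = expanding q + Re (correction q)"

lemma summable_golden: "summable (\<lambda>k. B / golden_ratio ^ Suc k)"
proof -
  have "summable (\<lambda>k. (1 / golden_ratio) ^ k)"
    using golden_ratio_gt_1 by (intro summable_geometric) simp
  then have "summable (\<lambda>k. B / golden_ratio * (1 / golden_ratio) ^ k)" by (rule summable_mult)
  then show ?thesis by (simp add: power_divide)
qed

lemma norm_logR_term:
  "norm (logR q / of_real (golden_ratio ^ Suc k)) = norm (logR q) / golden_ratio ^ Suc k"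
  using golden_ratio_gt_1 by (simp add: norm_divide norm_mult norm_power)

text \<open>Orbits stay in the bidisk, so one bound on \<open>logR\<close> serves all terms and the
  series is dominated by a geometric one of ratio 1 / phi.\<close>

lemma hol_correction: "holomorphic2_on correction bidisk"
proof -
  obtain B where B: "B \<ge> 0" "\<And>q. q \<in> bidisk \<Longrightarrow> norm (logR q) \<le> B" using logR_bound by blast
  show ?thesis unfolding correction_def[abs_def]
  proof (rule holomorphic2_on_suminf[OF open_bidisk])
    fix k
    have "holomorphic2_on (\<lambda>q. logR (fst ((step ^^ k) q), snd ((step ^^ k) q))) bidisk"
      using hol_iter[of k] by (intro holomorphic2_on_compose_pair[OF hol_logR]) (auto simp: iter_bidisk)
    then show "holomorphic2_on (\<lambda>q. logR ((step ^^ k) q) / of_real (golden_ratio ^ Suc k)) bidisk"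
      using golden_ratio_gt_1
      by (intro holomorphic2_on_divide holomorphic2_on_const open_bidisk) auto
    fix q assume "q \<in> bidisk"
    then show "norm (logR ((step ^^ k) q) / of_real (golden_ratio ^ Suc k)) \<le> B / golden_ratio ^ Suc k"
      unfolding norm_logR_term using golden_ratio_gt_1
      by (intro divide_right_mono B iter_bidisk) auto
  qed (rule summable_golden)
qed

lemma expanding_iter_tendsto:
  assumes "q \<in> punctured"
  shows "(\<lambda>n. expanding ((step ^^ n) q) / golden_ratio ^ n) \<longlonglongrightarrow> escape q"
proof -
  have gp: "golden_ratio > 0" using golden_ratio_gt_1 by linarith
  obtain B where B: "B \<ge> 0" "\<And>q. q \<in> bidisk \<Longrightarrow> norm (logR q) \<le> B" using logR_bound by blast
  have qb: "(step ^^ n) q \<in> bidisk" for n using iter_punctured[OF assms] by (simp add: punctured_def)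
  let ?t = "\<lambda>k. logR ((step ^^ k) q) / of_real (golden_ratio ^ Suc k)"
  have sm: "summable ?t"
  proof (rule summable_comparison_test'[OF summable_golden[of B]])
    show "norm (?t k) \<le> B / golden_ratio ^ Suc k" if "k \<ge> 0" for k
      unfolding norm_logR_term using gp by (intro divide_right_mono B qb) auto
  qed
  have "expanding ((step ^^ n) q) / golden_ratio ^ n = expanding q + Re (\<Sum>k<n. ?t k)" for n
  proof (induction n)
    case (Suc n)
    have "expanding ((step ^^ Suc n) q) / golden_ratio ^ Suc n =
      expanding ((step ^^ n) q) / golden_ratio ^ n + Re (logR ((step ^^ n) q)) / golden_ratio ^ Suc n"
      using expanding_step[OF iter_punctured[OF assms, of n]] gp by (simp add: add_divide_distrib)
    also have "Re (logR ((step ^^ n) q)) / golden_ratio ^ Suc n = Re (?t n)"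
      by (simp only: Re_divide_of_real)
    finally show ?case using Suc by simp
  qed simp
  moreover have "(\<lambda>n. expanding q + Re (\<Sum>k<n. ?t k)) \<longlonglongrightarrow> escape q"
    unfolding escape_def correction_def by (intro tendsto_intros summable_LIMSEQ sm)
  ultimately show ?thesis by simp
qed

lemma divide_golden_power_tendsto_0: "(\<lambda>n. K / golden_ratio ^ n) \<longlonglongrightarrow> 0"
  using golden_ratio_gt_1 by (rule LIMSEQ_divide_realpow_zero)

lemma contracting_iter_tendsto:
  assumes "q \<in> punctured"
  shows "(\<lambda>n. contracting ((step ^^ n) q) / golden_ratio ^ n) \<longlonglongrightarrow> 0"
proof -
  have gp: "golden_ratio > 0" using golden_ratio_gt_1 by linarith
  obtain B where B: "B \<ge> 0" "\<And>q. q \<in> bidisk \<Longrightarrow> norm (logR q) \<le> B" using logR_bound by blast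
  have qb: "(step ^^ n) q \<in> bidisk" for n using iter_punctured[OF assms] by (simp add: punctured_def)
  \<comment> \<open>\<open>K\<close> is preserved by t \<mapsto> (phi - 1) t + B, the worst case of
    the recursion; the denominator \<open>2 - golden_ratio\<close> is 1 - (phi - 1), positive since
    phi < 2.\<close>
  define K where "K = \<bar>contracting q\<bar> + B / (2 - golden_ratio)"
  have K: "(golden_ratio - 1) * K + B \<le> K"
  proof -
    have "(2 - golden_ratio) * K = (2 - golden_ratio) * \<bar>contracting q\<bar> + B"
      using golden_ratio_lt_2 by (simp add: K_def distrib_left)
    moreover have "(2 - golden_ratio) * \<bar>contracting q\<bar> \<ge> 0"
      using golden_ratio_lt_2 by (intro mult_nonneg_nonneg) auto
    ultimately have "B \<le> (2 - golden_ratio) * K" by linarith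
    then show ?thesis by (simp add: algebra_simps)
  qed
  have "\<bar>contracting ((step ^^ n) q)\<bar> \<le> K" for n
  proof (induction n)
    case 0
    then show ?case using B golden_ratio_lt_2 by (simp add: K_def)
  next
    case (Suc n)
    have "\<bar>contracting ((step ^^ Suc n) q)\<bar> \<le>
      \<bar>(1 - golden_ratio) * contracting ((step ^^ n) q)\<bar> + \<bar>Re (logR ((step ^^ n) q))\<bar>"
      using contracting_step[OF iter_punctured[OF assms, of n]] by simp
    also have "\<dots> \<le> (golden_ratio - 1) * K + B"
      unfolding abs_mult
      using golden_ratio_gt_1 Suc abs_Re_le_cmod[of "logR ((step ^^ n) q)"] B(2)[OF qb[of n]]
      by (intro add_mono mult_mono) auto
    finally show ?case using K by linarith
  qed
  then have "norm (contracting ((step ^^ n) q) / golden_ratio ^ n) \<le> K / golden_ratio ^ n" for n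
    using gp by (simp add: divide_right_mono)
  then show ?thesis
    by (intro Lim_null_comparison[OF _ divide_golden_power_tendsto_0[of K]]) auto
qed

text \<open>Subtracting the eigencoordinates isolates \<open>ln \<bar>Y\<bar>\<close> with
  coefficient 2 phi - 1, which is the square root of 5.\<close>

lemma ln_snd_iter_tendsto:
  assumes "q \<in> punctured"
  shows "(\<lambda>n. ln (norm (snd ((step ^^ n) q) - z0)) / golden_ratio ^ n) \<longlonglongrightarrow> escape q / (2 * golden_ratio - 1)"
proof -
  have eq: "ln (norm (snd p - z0)) = (expanding p - contracting p) / (2 * golden_ratio - 1)" for p
    using golden_ratio_gt_1 by (simp add: expanding_def contracting_def field_simps)
  have "(\<lambda>n. (expanding ((step ^^ n) q) / golden_ratio ^ n - contracting ((step ^^ n) q) / golden_ratio ^ n)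
      / (2 * golden_ratio - 1)) \<longlonglongrightarrow> (escape q - 0) / (2 * golden_ratio - 1)"
    using golden_ratio_gt_1
    by (intro tendsto_intros expanding_iter_tendsto contracting_iter_tendsto assms) auto
  then show ?thesis by (simp add: eq diff_divide_distrib mult.commute)
qed

text \<open>This yields \<open>h < 1\<close>: replacing \<open>ln \<bar>R\<bar>\<close> by its upper
  bound \<open>L\<close> shows that \<open>escape q\<close> is at most phi (ln r + L), and
  \<open>r * norm c \<le> 1 / 2\<close> makes this negative.\<close>

lemma escape_neg:
  assumes "q \<in> punctured"
  shows "escape q < 0"
proof -
  have gp: "golden_ratio > 0" using golden_ratio_gt_1 by linarith
  define L where "L = ln (3 / 2 * norm c)"
  have qb: "(step ^^ n) q \<in> bidisk" for n using iter_punctured[OF assms] by (simp add: punctured_def)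
  \<comment> \<open>The shift \<open>golden_ratio * L\<close> is the sum of
    \<open>L / golden_ratio ^ Suc k\<close>. With it the inequality becomes homogeneous, because phi
    L + L = phi (phi L).\<close>
  have step_le: "expanding ((step ^^ n) q) / golden_ratio ^ n + golden_ratio * L / golden_ratio ^ n
      \<le> expanding q + golden_ratio * L" for n
  proof (induction n)
    case (Suc n)
    have "Re (logR ((step ^^ n) q)) \<le> L"
      using R_bound[OF qb[of n]] R_nz[OF qb[of n]] by (simp add: Re_logR[OF qb] L_def ln_mono)
    then have "expanding ((step ^^ Suc n) q) + golden_ratio * L \<le>
      golden_ratio * (expanding ((step ^^ n) q) + golden_ratio * L)"
      using expanding_step[OF iter_punctured[OF assms, of n]] golden_ratio_square
      by (simp add: distrib_left flip: mult.assoc) (simp add: algebra_simps)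
    then have "(expanding ((step ^^ Suc n) q) + golden_ratio * L) / golden_ratio ^ Suc n \<le>
      golden_ratio * (expanding ((step ^^ n) q) + golden_ratio * L) / golden_ratio ^ Suc n"
      using gp by (intro divide_right_mono) auto
    also have "\<dots> = (expanding ((step ^^ n) q) + golden_ratio * L) / golden_ratio ^ n"
      using gp by simp
    finally show ?case using Suc by (simp add: add_divide_distrib)
  qed simp
  have "escape q + 0 \<le> expanding q + golden_ratio * L"
    by (rule LIMSEQ_le_const2[OF tendsto_add[OF expanding_iter_tendsto[OF assms]
            divide_golden_power_tendsto_0[of "golden_ratio * L"]]]) (use step_le in blast)
  moreover have "expanding q \<le> golden_ratio * ln r"
  proof -
    have "ln (norm (fst q - z0)) \<le> ln r" "ln (norm (snd q - z0)) \<le> ln r"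
      using assms by (auto simp: punctured_def bidisk_def dist_norm norm_minus_commute intro!: ln_mono)
    moreover from this(2) have "(golden_ratio - 1) * ln (norm (snd q - z0)) \<le> (golden_ratio - 1) * ln r"
      using golden_ratio_gt_1 by (intro mult_left_mono) auto
    ultimately show ?thesis by (simp add: expanding_def algebra_simps)
  qed
  moreover have "golden_ratio * (ln r + L) < 0"
  proof -
    have "ln r + L = ln (r * (3 / 2 * norm c))" using r_pos c_nz unfolding L_def by (intro ln_mult_pos[symmetric]) auto
    also have "\<dots> < 0" using small r_pos c_nz by (intro ln_less_zero) auto
    finally show ?thesis using gp by (simp add: mult_pos_neg)
  qed
  ultimately show ?thesis by (simp add: distrib_left)
qed

text \<open>Only the two logarithms in \<open>expanding\<close> need care. On a ball about
  \<open>fst q0\<close> that misses \<open>z0\<close> the quotient by \<open>a\<close> stays in the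
  right half-plane; likewise for the second coordinate.\<close>

lemma escape_pluriharmonic:
  assumes q0: "q0 \<in> punctured"
  obtains V F where "q0 \<in> V" "V \<subseteq> punctured" "holomorphic2_on F V" "\<And>q. q \<in> V \<Longrightarrow> escape q = Re (F q)"
proof -
  define a where "a = fst q0 - z0"
  define b where "b = snd q0 - z0"
  have ab: "a \<noteq> 0" "b \<noteq> 0" using q0 by (auto simp: punctured_def a_def b_def)
  define V where "V = punctured \<inter> (ball (fst q0) (norm a) \<times> ball (snd q0) (norm b))"
  have V: "open V" "q0 \<in> V" "V \<subseteq> punctured"
    using open_punctured q0 ab by (auto simp: V_def mem_Times_iff intro: open_Times)
  have dom: "w / d \<notin> \<real>\<^sub>\<le>\<^sub>0" if "d \<noteq> 0" "norm (w - d) < norm d" for w d :: complex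
  proof -
    have "norm (1 - w / d) < 1"
    proof -
      have "1 - w / d = - ((w - d) / d)" using that by (simp add: field_simps)
      then show ?thesis using that by (simp add: norm_divide)
    qed
    then have "\<bar>Re (1 - w / d)\<bar> < 1" using abs_Re_le_cmod[of "1 - w / d"] by linarith
    then have "Re (w / d) > 0" by simp
    then show ?thesis by (auto simp: complex_nonpos_Reals_iff)
  qed
  have holLn: "holomorphic2_on (\<lambda>q. Ln ((h q - z0) / d)) V"
    if "holomorphic2_on h V" "d \<noteq> 0" "\<And>q. q \<in> V \<Longrightarrow> norm (h q - z0 - d) < norm d" for h d
  proof (rule holomorphic2_on_compose[where S = "- \<real>\<^sub>\<le>\<^sub>0" and h = Ln])
    have "holomorphic2_on (\<lambda>q. (h q + - z0) / d) V"
      using that V by (intro holomorphic2_on_divide holomorphic2_on_add holomorphic2_on_const) auto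
    then show "holomorphic2_on (\<lambda>q. (h q - z0) / d) V" by simp
    show "Ln holomorphic_on - \<real>\<^sub>\<le>\<^sub>0" by (intro holomorphic_intros) auto
    show "(h q - z0) / d \<in> - \<real>\<^sub>\<le>\<^sub>0" if "q \<in> V" for q
      using dom[OF \<open>d \<noteq> 0\<close>] \<open>\<And>q. q \<in> V \<Longrightarrow> _\<close>[OF that] by auto
  qed (auto intro: open_Compl)
  \<comment> \<open>Adding \<open>Ln a\<close> and \<open>Ln b\<close> back restores the real parts
    \<open>ln \<bar>X\<bar>\<close> and \<open>ln \<bar>Y\<bar>\<close>.\<close>
  define F where "F = (\<lambda>q. (Ln ((fst q - z0) / a) + Ln a)
    + of_real (golden_ratio - 1) * (Ln ((snd q - z0) / b) + Ln b) + correction q)"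
  show ?thesis
  proof (rule that[of V F])
    show "holomorphic2_on F V" unfolding F_def
      by (intro holomorphic2_on_add holomorphic2_on_mult holomorphic2_on_const holLn
          holomorphic2_on_fst holomorphic2_on_snd holomorphic2_on_subset[OF hol_correction] V ab)
        (use V in \<open>auto simp: V_def a_def b_def dist_norm norm_minus_commute punctured_def\<close>)
    fix q assume "q \<in> V"
    then have "fst q \<noteq> z0" "snd q \<noteq> z0" using V by (auto simp: punctured_def)
    then show "escape q = Re (F q)"
      using ab by (simp add: F_def escape_def expanding_def norm_divide ln_div)
  qed (use V in auto)
qed

end

section \<open>Passage to an arbitrary norm\<close>

text \<open>By homogeneity \<open>N (X, Y)\<close> is \<open>norm Y\<close> times
  \<open>N (X / Y, 1)\<close>. The second factor tends to \<open>N (0, 1) > 0\<close>, so its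
  logarithm divided by phi^n vanishes in the limit.\<close>

lemma (in secant_germ) ln_norm_iter_tendsto:
  assumes N: "norm_on_C2 N" and q: "q \<in> punctured"
  shows "(\<lambda>n. ln (N ((step ^^ n) q - (z0, z0))) / golden_ratio ^ n) \<longlonglongrightarrow>
    escape q / (2 * golden_ratio - 1)"
    and "N ((step ^^ n) q - (z0, z0)) > 0"
proof -
  have qb: "q \<in> bidisk" using q by (simp add: punctured_def)
  define X where "X n = fst ((step ^^ n) q) - z0" for n
  define Y where "Y n = snd ((step ^^ n) q) - z0" for n
  have nz: "X n \<noteq> 0" "Y n \<noteq> 0" for n
    using iter_punctured[OF q, of n] by (auto simp: X_def Y_def punctured_def)
  have p_eq: "(step ^^ n) q - (z0, z0) = (X n, Y n)" for n
    by (simp add: X_def Y_def prod_eq_iff)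
  have N_pos: "N (x, y) > 0" if "y \<noteq> 0" for x y
    using N that unfolding norm_on_C2_def
    by (metis Pair_inject less_eq_real_def zero_prod_def)
  then show "N ((step ^^ n) q - (z0, z0)) > 0" using nz unfolding p_eq by blast
  have scale: "N (a * x, a * y) = norm a * N (x, y)" for a x y
    using N unfolding norm_on_C2_def by blast
  have tri: "N (v + w) \<le> N v + N w" for v w
    using N unfolding norm_on_C2_def by blast
  have lip: "\<bar>N (t, 1) - N (0, 1)\<bar> \<le> norm t * N (1, 0)" for t
    using tri[of "(t, 0)" "(0, 1)"] tri[of "(t, 1)" "(- t, 0)"] scale[of t 1 0] scale[of "- t" 1 0]
    by simp
  define S where "S n = N (X n / Y n, 1)" for n
  have split: "N (X n, Y n) = norm (Y n) * S n" for n
    using scale[of "Y n" "X n / Y n" 1] nz[of n] by (simp add: S_def)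
  have S_pos: "S n > 0" for n unfolding S_def by (rule N_pos) simp
  have "(\<lambda>n. norm (X n / Y n)) \<longlonglongrightarrow> 0"
  proof (rule LIMSEQ_imp_Suc)
    \<comment> \<open>The new \<open>Y\<close> is the old \<open>X\<close>, which cancels from the
      new \<open>X = X Y R\<close>.\<close>
    have "X (Suc n) / Y (Suc n) = Y n * R ((step ^^ n) q)" for n
      using nz[of n] by (simp add: X_def Y_def step_def)
    then have "norm (norm (X (Suc n) / Y (Suc n))) \<le> norm (Y n) * (3 / 2 * norm c)" for n
      using mult_left_mono[OF R_bound[OF iter_bidisk[OF qb, of n]] norm_ge_zero[of "Y n"]]
      by (simp add: norm_mult)
    moreover have "(\<lambda>n. norm (Y n) * (3 / 2 * norm c)) \<longlonglongrightarrow> 0"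
      unfolding Y_def
      by (intro tendsto_mult_left_zero tendsto_norm_zero LIM_zero iter_snd_tendsto qb)
    ultimately show "(\<lambda>n. norm (X (Suc n) / Y (Suc n))) \<longlonglongrightarrow> 0"
      by (rule Lim_null_comparison[OF always_eventually[OF allI]])
  qed
  then have "(\<lambda>n. norm (X n / Y n) * N (1, 0)) \<longlonglongrightarrow> 0" by (rule tendsto_mult_left_zero)
  then have "(\<lambda>n. S n - N (0, 1)) \<longlonglongrightarrow> 0"
    by (rule Lim_null_comparison[rotated]) (use lip in \<open>simp add: S_def\<close>)
  then have "S \<longlonglongrightarrow> N (0, 1)" by (rule LIM_zero_cancel)
  then have "(\<lambda>n. ln (S n)) \<longlonglongrightarrow> ln (N (0, 1))"
    using N_pos[of 1 0] by (intro tendsto_ln) auto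
  moreover have "(\<lambda>n. 1 / golden_ratio ^ n) \<longlonglongrightarrow> 0" by (rule divide_golden_power_tendsto_0)
  ultimately have "(\<lambda>n. ln (S n) * (1 / golden_ratio ^ n)) \<longlonglongrightarrow> ln (N (0, 1)) * 0"
    by (rule tendsto_mult)
  then have "(\<lambda>n. ln (norm (Y n)) / golden_ratio ^ n + ln (S n) / golden_ratio ^ n) \<longlonglongrightarrow>
      escape q / (2 * golden_ratio - 1) + 0"
    unfolding Y_def by (intro tendsto_add ln_snd_iter_tendsto q) simp
  moreover have "ln (N (X n, Y n)) = ln (norm (Y n)) + ln (S n)" for n
    unfolding split using nz S_pos by (intro ln_mult_pos) auto
  ultimately show "(\<lambda>n. ln (N ((step ^^ n) q - (z0, z0))) / golden_ratio ^ n) \<longlonglongrightarrow>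
      escape q / (2 * golden_ratio - 1)"
    unfolding p_eq by (simp add: add_divide_distrib)
qed

section \<open>The basin of attraction\<close>

locale secant_root = secant U f + secant_germ z0 r R c
  for U f z0 r R c +
  fixes N :: "complex \<times> complex \<Rightarrow> real"
  assumes ball_subset: "ball z0 r \<subseteq> U" and N: "norm_on_C2 N"
    and secant_map_germ: "q \<in> bidisk \<Longrightarrow> secant_map U f q = Some (embed (step q))"
begin

lemma bidisk_subset: "bidisk \<subseteq> U \<times> U"
  using ball_subset by (auto simp: bidisk_def)

lemma center_bidisk: "(z0, z0) \<in> bidisk"
  using r_pos by (simp add: bidisk_def)

lemma secant_iterate_bidisk:
  assumes "q \<in> bidisk"
  shows "secant_iterate U f n q = Some (embed ((step ^^ n) q))"
proof (induction n)
  case 0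
  then show ?case using assms bidisk_subset by auto
next
  case (Suc n)
  show ?case
    using secant_iterate_Suc[OF Suc] secant_map_germ[OF iter_bidisk[OF assms, of n]] by simp
qed

text \<open>The time \<open>n\<close> need not be the first entry, so one \<open>n\<close> can later
  serve a whole neighborhood of \<open>p\<close>.\<close>

definition enters :: "complex \<times> complex \<Rightarrow> nat \<Rightarrow> complex \<times> complex \<Rightarrow> bool" where
  "enters p n q \<longleftrightarrow> q \<in> bidisk \<and> secant_iterate U f n p = Some (embed q)"

lemma secant_iterate_enters:
  assumes "enters p n q"
  shows "secant_iterate U f (m + n) p = Some (embed ((step ^^ m) q))"
  using assms bidisk_subset secant_iterate_bidisk[of q m] secant_iterate_add[of n p q m]
  by (auto simp: enters_def)

lemma secant_orbit_enters:
  assumes "enters p n q"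
  shows "secant_orbit U f p (m + n) = (step ^^ m) q"
  by (rule secant_orbit_eqI[OF secant_iterate_enters[OF assms]])

lemma enters_imp_basin:
  assumes "enters p n q"
  shows "p \<in> secant_basin U f z0"
proof -
  have it: "\<exists>q\<in>U \<times> U. secant_iterate U f k p = Some (embed q)" for k
  proof -
    \<comment> \<open>Any time beyond \<open>k\<close> would do; \<open>Suc k + n\<close> makes the
      strict inequality of \<open>secant_iterate_pred\<close> hold.\<close>
    have "secant_iterate U f (Suc k + n) p = Some (embed ((step ^^ Suc k) q))"
      by (rule secant_iterate_enters[OF assms])
    then show ?thesis by (rule secant_iterate_pred) simp
  qed
  have "p \<in> U \<times> U" using it[of 0] by (auto split: if_splits)
  moreover have "secant_orbit U f p \<longlonglongrightarrow> (z0, z0)"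
  proof (rule LIMSEQ_offset)
    show "(\<lambda>m. secant_orbit U f p (m + n)) \<longlonglongrightarrow> (z0, z0)"
      unfolding secant_orbit_enters[OF assms]
      by (rule iter_tendsto) (use assms in \<open>simp add: enters_def\<close>)
  qed
  ultimately show ?thesis using it by (simp add: secant_basin_def)
qed

lemma basin_imp_enters:
  assumes "p \<in> secant_basin U f z0"
  obtains n q where "enters p n q"
proof -
  have it: "\<exists>q\<in>U \<times> U. secant_iterate U f n p = Some (embed q)" for n
    using assms by (auto simp: secant_basin_def)
  have lim: "secant_orbit U f p \<longlonglongrightarrow> (z0, z0)"
    using assms by (simp add: secant_basin_def)
  have "\<forall>\<^sub>F n in sequentially. secant_orbit U f p n \<in> bidisk"
    using topological_tendstoD[OF lim open_bidisk center_bidisk] .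
  then obtain n where n: "secant_orbit U f p n \<in> bidisk"
    using eventually_happens by force
  obtain q where "secant_iterate U f n p = Some (embed q)" using it by blast
  then have "enters p n q" using n secant_orbit_eqI by (auto simp: enters_def)
  then show ?thesis by (rule that)
qed

text \<open>The delay \<open>n\<close> splits the exponent as 1 / phi^(m+n) = 1 / phi^m / phi^n,
  which accounts for the last factor in the denominator.\<close>

lemma potential_approx_tendsto_punctured:
  assumes "enters p n q" "q \<in> punctured"
  shows "potential_approx N U f z0 p \<longlonglongrightarrow> exp (escape q / ((2 * golden_ratio - 1) * golden_ratio ^ n))"
proof (rule LIMSEQ_offset[of _ n])
  have gp: "golden_ratio > 0" using golden_ratio_gt_1 by linarith
  have "potential_approx N U f z0 p (m + n) =
      exp (ln (N ((step ^^ m) q - (z0, z0))) / golden_ratio ^ m / golden_ratio ^ n)" for m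
    using ln_norm_iter_tendsto(2)[OF N assms(2), of m] gp
    by (simp add: potential_approx_def secant_orbit_enters[OF assms(1)] powr_def power_add)
  moreover have "(\<lambda>m. exp (ln (N ((step ^^ m) q - (z0, z0))) / golden_ratio ^ m / golden_ratio ^ n))
      \<longlonglongrightarrow> exp (escape q / (2 * golden_ratio - 1) / golden_ratio ^ n)"
    using gp by (intro tendsto_intros ln_norm_iter_tendsto(1) N assms) auto
  ultimately show "(\<lambda>m. potential_approx N U f z0 p (m + n)) \<longlonglongrightarrow>
      exp (escape q / ((2 * golden_ratio - 1) * golden_ratio ^ n))" by simp
qed

text \<open>The orbit sits on the fixed point from time \<open>2 + n\<close> on, and
  \<open>0 powr a = 0\<close> makes the approximants vanish.\<close>

lemma potential_approx_tendsto_not_punctured: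
  assumes "enters p n q" "q \<notin> punctured"
  shows "potential_approx N U f z0 p \<longlonglongrightarrow> 0"
proof (rule LIMSEQ_offset[of _ "2 + n"])
  have "N 0 = 0" using N unfolding norm_on_C2_def by blast
  then have "potential_approx N U f z0 p (m + (2 + n)) = 0" for m
    using secant_orbit_enters[OF assms(1), of "m + 2"] iter_not_punctured[of q m] assms
    by (simp add: potential_approx_def enters_def add.assoc)
  then show "(\<lambda>m. potential_approx N U f z0 p (m + (2 + n))) \<longlonglongrightarrow> 0" by simp
qed

lemma potential_punctured:
  assumes "enters p n q" "q \<in> punctured"
  shows "potential N U f z0 p = exp (escape q / ((2 * golden_ratio - 1) * golden_ratio ^ n))"
  unfolding potential_def by (rule limI[OF potential_approx_tendsto_punctured[OF assms]])

lemma potential_not_punctured: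
  assumes "enters p n q" "q \<notin> punctured"
  shows "potential N U f z0 p = 0"
  unfolding potential_def by (rule limI[OF potential_approx_tendsto_not_punctured[OF assms]])

lemma potential_range:
  assumes "p \<in> secant_basin U f z0"
  shows "convergent (potential_approx N U f z0 p)" "potential N U f z0 p \<in> {0..<1}"
proof -
  obtain n q where e: "enters p n q" using basin_imp_enters[OF assms] .
  have "escape q / ((2 * golden_ratio - 1) * golden_ratio ^ n) < 0" if "q \<in> punctured"
    using escape_neg[OF that] golden_ratio_gt_1 by (intro divide_neg_pos mult_pos_pos) auto
  then show "potential N U f z0 p \<in> {0..<1}"
    using potential_punctured[OF e] potential_not_punctured[OF e] by (cases "q \<in> punctured") auto
  show "convergent (potential_approx N U f z0 p)"
    using potential_approx_tendsto_punctured[OF e] potential_approx_tendsto_not_punctured[OF e]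
    by (cases "q \<in> punctured") (auto simp: convergent_def)
qed

text \<open>Vanishing excludes the exponential value, so the entry point lies on an axis and reaches
  the center two steps later. Conversely the center is itself an unpunctured entry point.\<close>

lemma zero_set_potential:
  "{p \<in> secant_basin U f z0. potential N U f z0 p = 0} = (\<Union>n. secant_preimage U f n {(z0, z0)})"
proof safe
  fix a b assume p: "(a, b) \<in> secant_basin U f z0" and pot: "potential N U f z0 (a, b) = 0"
  obtain n q where e: "enters (a, b) n q" using basin_imp_enters[OF p] .
  have "q \<notin> punctured" using potential_punctured[OF e] pot by (metis exp_not_eq_zero)
  then have "(step ^^ (0 + 2)) q = (z0, z0)"
    using e by (intro iter_not_punctured) (auto simp: enters_def)
  then have "secant_iterate U f (2 + n) (a, b) = Some (embed (z0, z0))"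
    using secant_iterate_enters[OF e, of 2] by (simp only: add_0)
  moreover have "(a, b) \<in> U \<times> U" using p by (simp add: secant_basin_def)
  ultimately have "(a, b) \<in> secant_preimage U f (2 + n) {(z0, z0)}"
    unfolding secant_preimage_def by blast
  then show "(a, b) \<in> (\<Union>n. secant_preimage U f n {(z0, z0)})" by blast
next
  fix a b n assume "(a, b) \<in> secant_preimage U f n {(z0, z0)}"
  then have e: "enters (a, b) n (z0, z0)"
    using center_bidisk by (simp add: enters_def secant_preimage_def)
  show "(a, b) \<in> secant_basin U f z0" by (rule enters_imp_basin[OF e])
  show "potential N U f z0 (a, b) = 0"
    by (rule potential_not_punctured[OF e]) (simp add: punctured_def)
qed

text \<open>Near \<open>p\<close> the Green's function is \<open>escape\<close> composed with the
  local holomorphic iterate, divided by a positive constant; pluriharmonicity is pulled back along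
  that iterate.\<close>

lemma green_pluriharmonic:
  assumes p: "p \<in> secant_basin U f z0" and fin: "potential N U f z0 p \<noteq> 0"
  shows "pluriharmonic_at (secant_basin U f z0) (green N U f z0) p"
proof -
  obtain n q where e: "enters p n q" using basin_imp_enters[OF p] .
  have q: "q \<in> punctured" using potential_not_punctured[OF e] fin by blast
  obtain W F where W: "q \<in> W" "W \<subseteq> punctured" "holomorphic2_on F W"
    and F: "\<And>q. q \<in> W \<Longrightarrow> escape q = Re (F q)"
    using escape_pluriharmonic[OF q] by blast
  obtain V H1 H2 where V: "p \<in> V" "V \<subseteq> U \<times> U" and H: "holomorphic2_on H1 V" "holomorphic2_on H2 V"
    and it: "\<forall>p'\<in>V. secant_iterate U f n p' = Some (embed (H1 p', H2 p'))"
    using secant_iterate_local[of n p q] e unfolding enters_def by blast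
  define V' where "V' = V \<inter> (\<lambda>z. (H1 z, H2 z)) -` W"
  have oV': "open V'"
    unfolding V'_def by (rule holomorphic2_on_open_preimage[OF H holomorphic2_on_open[OF W(3)]])
  have H': "holomorphic2_on H1 V'" "holomorphic2_on H2 V'"
    using H oV' by (auto intro: holomorphic2_on_subset simp: V'_def)
  \<comment> \<open>The same \<open>n\<close> works on all of \<open>V'\<close>, so the constant
    \<open>K\<close> below does not depend on \<open>p'\<close>.\<close>
  have e': "enters p' n (H1 p', H2 p')" "(H1 p', H2 p') \<in> W" if "p' \<in> V'" for p'
    using that it W(2) by (auto simp: enters_def V'_def punctured_def)
  have "(H1 p, H2 p) = q"
    using it V(1) e unfolding enters_def by (simp del: embed_Pair)
  then have pV': "p \<in> V'" using V W by (simp add: V'_def)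
  define K where "K = (2 * golden_ratio - 1) * golden_ratio ^ n"
  have K: "K > 0" using golden_ratio_gt_1 unfolding K_def by (intro mult_pos_pos) auto
  have "green N U f z0 p' = ereal (Re (F (H1 p', H2 p') / of_real K))" if "p' \<in> V'" for p'
  proof -
    have "potential N U f z0 p' = exp (escape (H1 p', H2 p') / K)"
      unfolding K_def using potential_punctured[OF e'(1)[OF that]] e'(2)[OF that] W(2) by blast
    then show ?thesis using F[OF e'(2)[OF that]] by (simp add: green_def)
  qed
  moreover have "holomorphic2_on (\<lambda>p'. F (H1 p', H2 p') / of_real K) V'"
    using K by (intro holomorphic2_on_divide holomorphic2_on_const oV'
        holomorphic2_on_compose_pair[OF W(3) H'] e'(2)) auto
  moreover have "V' \<subseteq> secant_basin U f z0" using enters_imp_basin e'(1) by blast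
  ultimately show ?thesis unfolding pluriharmonic_at_def using oV' pV' by blast
qed

end

theorem mainTheorem3:
  fixes U :: "complex set" and f :: "complex \<Rightarrow> complex" and z0 :: complex
    and N :: "complex \<times> complex \<Rightarrow> real"
  assumes "open U" and "connected U"
    and "f nicely_meromorphic_on U" and "\<not> f constant_on U"
    and "z0 \<in> U" and "\<not> is_pole f z0" and "f z0 = 0" and "deriv f z0 \<noteq> 0"
    and "deriv (deriv f) z0 \<noteq> 0"
    and "norm_on_C2 N"
  shows "(\<forall>p \<in> secant_basin U f z0.
            convergent (potential_approx N U f z0 p) \<and> potential N U f z0 p \<in> {0..<1}) \<and>
         {p \<in> secant_basin U f z0. potential N U f z0 p = 0} =
            (\<Union>n. secant_preimage U f n {(z0, z0)}) \<and>
         (\<forall>p \<in> secant_basin U f z0. \<bar>green N U f z0 p\<bar> \<noteq> \<infinity> \<longrightarrow>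
            pluriharmonic_at (secant_basin U f z0) (green N U f z0) p)"
proof -
  interpret secant U f using assms(1-4) by unfold_locales
  obtain r R c where germ: "r > 0" "ball z0 r \<subseteq> U" "holomorphic2_on R (ball z0 r \<times> ball z0 r)" "c \<noteq> 0"
    "\<And>q. q \<in> ball z0 r \<times> ball z0 r \<Longrightarrow> norm (R q / c - 1) < 1 / 2" "r * norm c \<le> 1 / 2"
    and map: "\<And>q. q \<in> ball z0 r \<times> ball z0 r \<Longrightarrow>
       secant_map U f q = Some (Fin (z0 + (fst q - z0) * (snd q - z0) * R q), Fin (fst q))"
    using secant_map_near_simple_root[OF assms(5-9)] by blast
  interpret secant_germ z0 r R c
    using germ(1,3-6) by unfold_locales
  interpret secant_root U f z0 r R c N
    using germ(2) assms(10) map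
    by unfold_locales (simp_all add: bidisk_def step_def)
  show ?thesis
    \<comment> \<open>By its definition \<open>green\<close> is infinite exactly where
      \<open>potential\<close> is 0, so finiteness is the hypothesis of
      \<open>green_pluriharmonic\<close>.\<close>
    using potential_range zero_set_potential green_pluriharmonic
    by (auto simp: green_def Let_def)
qed

end
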